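(* Fix the number $l\ge 1$ of circle components. Let $\iota$ be the linear map from the space of wedge diagrams on $l$ components to the space $\mathcal{A}^{c}\cong\mathcal{A}^{t}$ which sends a wedge diagram with wedges $w_1,\dots,w_m$ to the alternating sum, over all choices of one leg from each wedge, of the chord diagrams obtained by keeping only the chosen legs (as chords from the tip to the end of the leg), with sign $(-1)^{\#\{\text{chosen legs labelled } -\}}$. Then the image of $\iota$ is the subspace $\mathcal{A}^{st}$ of $\mathcal{A}^{t}$ spanned by the strutless diagrams, i.e. the trivalent diagrams in which there is no chord having both its ends as external vertices.
   Context: All spaces are $\mathbb{Q}$-vector spaces. A wedge diagram of degree $m$ on $l$ components is a collection of $l$ oriented ordered circles and $m$ dashed wedges, with all tips and leg ends distinct. The tip of each wedge lies on one circle and both its legs end on another (maybe the same) circle; the two legs of each wedge are labelled $+$ and $-$. A chord diagram is a disjoint union of $l$ oriented ordered circles with dashed chords attached to them at distinct end points; $\mathcal{A}^c$ is the span of chord diagrams modulo the 4-T relation. A trivalent diagram consists of $l$ oriented ordered circles together with a dashed graph. The vertices of the dashed graph are either external (univalent in the dashed graph, lying on a circle) or internal (trivalent, each with a cyclic ordering of its three edges), and every connected component of the dashed graph has at least one external vertex. The edges of the dashed graph are also called chords. $\mathcal{A}^t$ is the span of trivalent diagrams modulo the AS relation (reversing the cyclic order at an internal vertex changes the sign), the STU relation and the 4-T relation. The STU relation says that a diagram with an internal vertex joined by an edge to an external vertex on a circle equals the difference of the two diagrams in which that edge is removed and the other two edges are attached directly to the circle in the two possible orders. The inclusion of chord diagrams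 into trivalent diagrams induces the standard isomorphism $\mathcal{A}^c\cong\mathcal{A}^t$, by which $\iota$ is viewed as a map into $\mathcal{A}^t$. *)

theory Defs
  imports Complex_Main "HOL-Library.Poly_Mapping" "HOL-Library.Disjoint_Sets"
begin

text \<open>
  The circle components are indexed by a finite type \<open>'l\<close>, so \<open>l = CARD('l) \<ge> 1\<close>, and are not
  interchangeable.  End points of dashed lines are named by natural numbers.  The points on the
  circle \<open>i\<close> are recorded as the list \<open>c i\<close>, read along the orientation from an arbitrary starting
  point.  Diagrams are such presentations up to rotation of each list and renaming of the labels.
\<close>

section \<open>Points on circles\<close>

type_synonym 'l circles = "'l \<Rightarrow> nat list"

definition points :: "'l circles \<Rightarrow> nat set" where
  "points c = (\<Union>i. set (c i))"

definition wf_circles :: "'l circles \<Rightarrow> bool" where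
  "wf_circles c \<longleftrightarrow> (\<forall>i. distinct (c i)) \<and> (\<forall>i j. i \<noteq> j \<longrightarrow> set (c i) \<inter> set (c j) = {})"

definition circles_iso :: "(nat \<Rightarrow> nat) \<Rightarrow> 'l circles \<Rightarrow> 'l circles \<Rightarrow> bool" where
  "circles_iso f c c' \<longleftrightarrow> (\<forall>i. \<exists>k. c' i = rotate k (map f (c i)))"

definition replace_point :: "nat \<Rightarrow> nat list \<Rightarrow> 'l circles \<Rightarrow> 'l circles" where
  "replace_point a xs c = (\<lambda>i. concat (map (\<lambda>z. if z = a then xs else [z]) (c i)))"

lemma circles_iso_id: "circles_iso id c c"
  unfolding circles_iso_def by (metis list.map_id rotate0 id_apply)

lemma circles_iso_trans:
  assumes "circles_iso f c c'" "circles_iso g c' c''"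
  shows "circles_iso (g \<circ> f) c c''"
  using assms unfolding circles_iso_def
  by (metis (no_types, lifting) map_map rotate_map rotate_rotate)

lemma rotate_inverse: "\<exists>k'. rotate k' (rotate k xs) = xs"
proof (cases "xs = []")
  case False
  then have "(length xs - k mod length xs + k) mod length xs = 0"
    by (metis add.commute le_add_diff_inverse length_greater_0_conv less_imp_le mod_add_left_eq
        mod_less_divisor mod_self)
  then have "rotate (length xs - k mod length xs) (rotate k xs) = xs"
    by (simp add: rotate_rotate rotate_id)
  then show ?thesis by blast
qed simp

lemma circles_iso_sym:
  assumes "bij f" "circles_iso f c c'"
  shows "circles_iso (inv f) c' c"
  unfolding circles_iso_def
proof
  fix i
  obtain k where k: "c' i = rotate k (map f (c i))"
    using assms(2) unfolding circles_iso_def by blast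
  obtain k' where k': "rotate k' (rotate k (c i)) = c i"
    using rotate_inverse by blast
  have "map (inv f) (c' i) = rotate k (c i)"
    using assms(1) by (simp add: k rotate_map[symmetric] bij_is_inj o_def)
  then show "\<exists>k. c i = rotate k (map (inv f) (c' i))"
    using k' by metis
qed

lemma filter_rotate: "\<exists>k'. filter P (rotate k xs) = rotate k' (filter P xs)"
proof (induction k)
  case 0
  show ?case by (intro exI[of _ 0]) simp
next
  case (Suc k)
  then obtain k' where k': "filter P (rotate k xs) = rotate k' (filter P xs)" by blast
  have "filter P (rotate1 ys) = filter P ys \<or> filter P (rotate1 ys) = rotate1 (filter P ys)" for ys
    by (cases ys) auto
  then have "filter P (rotate (Suc k) xs) = rotate k' (filter P xs) \<or>
      filter P (rotate (Suc k) xs) = rotate (Suc k') (filter P xs)"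
    by (simp add: k'[symmetric])
  then show ?case by blast
qed

section \<open>Diagrams\<close>

subsection \<open>Chord diagrams\<close>

datatype 'l chord_pres = Chord_Pres (ccircles: "'l circles") (cchords: "nat set set")

definition wf_chord :: "'l chord_pres \<Rightarrow> bool" where
  "wf_chord D \<longleftrightarrow> wf_circles (ccircles D) \<and> partition_on (points (ccircles D)) (cchords D) \<and>
     (\<forall>c\<in>cchords D. card c = 2)"

text \<open>
  Only finitely many labels occur in a diagram, so every renaming of its labels extends to a
  bijection of all natural numbers.
\<close>
definition chord_iso :: "'l chord_pres \<Rightarrow> 'l chord_pres \<Rightarrow> bool" where
  "chord_iso D D' \<longleftrightarrow> wf_chord D \<and> wf_chord D' \<and>
     (\<exists>f. bij f \<and> circles_iso f (ccircles D) (ccircles D') \<and> cchords D' = (\<lambda>c. f ` c) ` cchords D)"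

lemma wf_chord_empty: "wf_chord (Chord_Pres (\<lambda>_. []) {})"
  by (simp add: wf_chord_def wf_circles_def points_def partition_on_def)

lemma chord_iso_refl: "wf_chord D \<Longrightarrow> chord_iso D D"
  unfolding chord_iso_def by (intro conjI exI[of _ id]) (auto simp: circles_iso_id)

lemma image_image_inv: "bij f \<Longrightarrow> (\<lambda>c. inv f ` c) ` (\<lambda>c. f ` c) ` C = C"
  by (simp add: image_image bij_is_inj image_comp)

lemma part_equivp_chord_iso: "part_equivp chord_iso"
proof (rule part_equivpI)
  show "\<exists>D. chord_iso D D"
    using chord_iso_refl wf_chord_empty by blast
  show "symp chord_iso"
  proof (rule sympI)
    fix D D' :: "'l chord_pres"
    assume "chord_iso D D'"
    then obtain f where f: "wf_chord D" "wf_chord D'" "bij f"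
      "circles_iso f (ccircles D) (ccircles D')" "cchords D' = (\<lambda>c. f ` c) ` cchords D"
      unfolding chord_iso_def by blast
    show "chord_iso D' D"
      unfolding chord_iso_def
      using f by (intro conjI exI[of _ "inv f"]) (auto simp: circles_iso_sym bij_imp_bij_inv image_image_inv)
  qed
  show "transp chord_iso"
  proof (rule transpI)
    fix D D' D'' :: "'l chord_pres"
    assume iso: "chord_iso D D'" "chord_iso D' D''"
    from iso obtain f g where fg: "wf_chord D" "wf_chord D''" "bij f" "bij g"
      "circles_iso f (ccircles D) (ccircles D')" "cchords D' = (\<lambda>c. f ` c) ` cchords D"
      "circles_iso g (ccircles D') (ccircles D'')" "cchords D'' = (\<lambda>c. g ` c) ` cchords D'"
      unfolding chord_iso_def by (elim conjE exE) (rule that)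
    have "cchords D'' = (\<lambda>c. (g \<circ> f) ` c) ` cchords D"
      by (simp only: fg(6,8) image_image comp_def)
    moreover have "bij (g \<circ> f)" "circles_iso (g \<circ> f) (ccircles D) (ccircles D'')"
      using fg(3,4) bij_comp circles_iso_trans[OF fg(5,7)] by blast+
    ultimately show "chord_iso D D''"
      unfolding chord_iso_def using fg(1,2) by blast
  qed
qed

quotient_type 'l chord_diagram = "'l chord_pres" / partial: chord_iso
  by (rule part_equivp_chord_iso)

subsection \<open>Trivalent diagrams\<close>

text \<open>
  The labels name half-edges of the dashed graph.  An external vertex is identified with its only
  half-edge.  An internal vertex is its cyclic order, given as the successor relation on its three
  half-edges; thus the converse relation is the reversed cyclic order.  A chord is the set of its
  two half-edges.
\<close>
definition cyc3 :: "nat \<Rightarrow> nat \<Rightarrow> nat \<Rightarrow> nat rel" where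
  "cyc3 x y z = {(x, y), (y, z), (z, x)}"

datatype 'l tri_pres =
  Tri_Pres (tcircles: "'l circles") (tchords: "nat set set") (tverts: "nat rel set")

definition external :: "'l tri_pres \<Rightarrow> nat set" where
  "external D = points (tcircles D)"

definition internal :: "'l tri_pres \<Rightarrow> nat set" where
  "internal D = (\<Union>v\<in>tverts D. Field v)"

definition adjacency :: "'l tri_pres \<Rightarrow> nat rel" where
  "adjacency D = {(h, h'). \<exists>c\<in>tchords D. h \<in> c \<and> h' \<in> c} \<union> \<Union>(tverts D)"

definition wf_tri :: "'l tri_pres \<Rightarrow> bool" where
  "wf_tri D \<longleftrightarrow> wf_circles (tcircles D) \<and>
     finite (tverts D) \<and>
     (\<forall>v\<in>tverts D. \<exists>x y z. distinct [x, y, z] \<and> v = cyc3 x y z) \<and>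
     (\<forall>v\<in>tverts D. \<forall>w\<in>tverts D. v \<noteq> w \<longrightarrow> Field v \<inter> Field w = {}) \<and>
     external D \<inter> internal D = {} \<and>
     partition_on (external D \<union> internal D) (tchords D) \<and>
     (\<forall>c\<in>tchords D. card c = 2) \<and>
     (\<forall>h \<in> external D \<union> internal D. \<exists>e\<in>external D. (h, e) \<in> (adjacency D)\<^sup>*)"

definition tri_iso :: "'l tri_pres \<Rightarrow> 'l tri_pres \<Rightarrow> bool" where
  "tri_iso D D' \<longleftrightarrow> wf_tri D \<and> wf_tri D' \<and>
     (\<exists>f. bij f \<and> circles_iso f (tcircles D) (tcircles D') \<and>
       tchords D' = (\<lambda>c. f ` c) ` tchords D \<and>
       tverts D' = (\<lambda>v. map_prod f f ` v) ` tverts D)"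

definition strutless :: "'l tri_pres \<Rightarrow> bool" where
  "strutless D \<longleftrightarrow> \<not> (\<exists>c\<in>tchords D. c \<subseteq> external D)"

definition chord_to_tri :: "'l chord_pres \<Rightarrow> 'l tri_pres" where
  "chord_to_tri D = Tri_Pres (ccircles D) (cchords D) {}"

lemma wf_chord_to_tri: "wf_chord D \<Longrightarrow> wf_tri (chord_to_tri D)"
  by (auto simp: wf_chord_def wf_tri_def chord_to_tri_def external_def internal_def)

lemma tri_iso_refl: "wf_tri D \<Longrightarrow> tri_iso D D"
  unfolding tri_iso_def by (intro conjI exI[of _ id]) (auto simp: circles_iso_id prod.map_id0)

lemma image_map_prod_inv:
  assumes "bij f"
  shows "(\<lambda>v. map_prod (inv f) (inv f) ` v) ` (\<lambda>v. map_prod f f ` v) ` V = V"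
proof -
  have "map_prod (inv f) (inv f) \<circ> map_prod f f = id"
    using assms by (simp add: map_prod_compose[symmetric] bij_is_inj prod.map_id0)
  then have "map_prod (inv f) (inv f) ` map_prod f f ` v = v" for v
    by (simp only: image_comp image_id id_apply)
  then show ?thesis
    by (simp add: image_image[of "\<lambda>v. map_prod (inv f) (inv f) ` v"])
qed

lemma part_equivp_tri_iso: "part_equivp tri_iso"
proof (rule part_equivpI)
  show "\<exists>D. tri_iso D D"
    using tri_iso_refl wf_chord_to_tri wf_chord_empty by blast
  show "symp tri_iso"
  proof (rule sympI)
    fix D D' :: "'l tri_pres"
    assume "tri_iso D D'"
    then obtain f where f: "wf_tri D" "wf_tri D'" "bij f"
      "circles_iso f (tcircles D) (tcircles D')" "tchords D' = (\<lambda>c. f ` c) ` tchords D"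
      "tverts D' = (\<lambda>v. map_prod f f ` v) ` tverts D"
      unfolding tri_iso_def by blast
    have "tchords D = (\<lambda>c. inv f ` c) ` tchords D'"
      "tverts D = (\<lambda>v. map_prod (inv f) (inv f) ` v) ` tverts D'"
      using f(3) by (simp_all only: f(5,6) image_image_inv image_map_prod_inv)
    moreover have "bij (inv f)" "circles_iso (inv f) (tcircles D') (tcircles D)"
      using f(3,4) by (simp_all add: bij_imp_bij_inv circles_iso_sym)
    ultimately show "tri_iso D' D"
      unfolding tri_iso_def using f(1,2) by blast
  qed
  show "transp tri_iso"
  proof (rule transpI)
    fix D D' D'' :: "'l tri_pres"
    assume iso: "tri_iso D D'" "tri_iso D' D''"
    from iso obtain f g where fg: "wf_tri D" "wf_tri D''" "bij f" "bij g"
      "circles_iso f (tcircles D) (tcircles D')" "tchords D' = (\<lambda>c. f ` c) ` tchords D"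
      "tverts D' = (\<lambda>v. map_prod f f ` v) ` tverts D"
      "circles_iso g (tcircles D') (tcircles D'')" "tchords D'' = (\<lambda>c. g ` c) ` tchords D'"
      "tverts D'' = (\<lambda>v. map_prod g g ` v) ` tverts D'"
      unfolding tri_iso_def by (elim conjE exE) (rule that)
    have map2: "map_prod g g ` map_prod f f ` v = map_prod (g \<circ> f) (g \<circ> f) ` v" for v
      by (simp only: image_comp map_prod_compose)
    have "tchords D'' = (\<lambda>c. (g \<circ> f) ` c) ` tchords D"
      by (simp only: fg(6,9) image_image comp_def)
    moreover have "tverts D'' = (\<lambda>v. map_prod (g \<circ> f) (g \<circ> f) ` v) ` tverts D"
      by (simp only: fg(7,10) map2 image_image[of "\<lambda>v. map_prod g g ` v"])
    moreover have "bij (g \<circ> f)" "circles_iso (g \<circ> f) (tcircles D) (tcircles D'')"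
      using fg(3,4) bij_comp circles_iso_trans[OF fg(5,8)] by blast+
    ultimately show "tri_iso D D''"
      unfolding tri_iso_def using fg(1,2) by blast
  qed
qed

quotient_type 'l trivalent_diagram = "'l tri_pres" / partial: tri_iso
  by (rule part_equivp_tri_iso)

lift_definition trivalent_of_chord :: "'l chord_diagram \<Rightarrow> 'l trivalent_diagram"
  is chord_to_tri
  unfolding chord_iso_def tri_iso_def
  by (auto simp: wf_chord_to_tri) (auto simp: chord_to_tri_def)

subsection \<open>Wedge diagrams\<close>

text \<open>A wedge is the triple of its tip, the end of its leg \<open>+\<close> and the end of its leg \<open>-\<close>.\<close>

type_synonym wedge = "nat \<times> nat \<times> nat"

definition wedge_points :: "wedge \<Rightarrow> nat set" where
  "wedge_points = (\<lambda>(t, p, m). {t, p, m})"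

datatype 'l wedge_pres = Wedge_Pres (wcircles: "'l circles") (wedges: "wedge set")

definition wf_wedge :: "'l wedge_pres \<Rightarrow> bool" where
  "wf_wedge W \<longleftrightarrow> wf_circles (wcircles W) \<and> finite (wedges W) \<and>
     (\<forall>(t, p, m)\<in>wedges W. distinct [t, p, m] \<and> (\<exists>i. p \<in> set (wcircles W i) \<and> m \<in> set (wcircles W i))) \<and>
     (\<forall>w\<in>wedges W. \<forall>w'\<in>wedges W. w \<noteq> w' \<longrightarrow> wedge_points w \<inter> wedge_points w' = {}) \<and>
     points (wcircles W) = (\<Union>w\<in>wedges W. wedge_points w)"

definition map_wedge :: "(nat \<Rightarrow> nat) \<Rightarrow> wedge \<Rightarrow> wedge" where
  "map_wedge f = (\<lambda>(t, p, m). (f t, f p, f m))"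

definition wedge_iso :: "'l wedge_pres \<Rightarrow> 'l wedge_pres \<Rightarrow> bool" where
  "wedge_iso W W' \<longleftrightarrow> wf_wedge W \<and> wf_wedge W' \<and>
     (\<exists>f. bij f \<and> circles_iso f (wcircles W) (wcircles W') \<and> wedges W' = map_wedge f ` wedges W)"

lemma wedge_iso_refl: "wf_wedge W \<Longrightarrow> wedge_iso W W"
  unfolding wedge_iso_def
  by (intro conjI exI[of _ id]) (auto simp: circles_iso_id map_wedge_def)

lemma map_wedge_comp: "map_wedge g (map_wedge f w) = map_wedge (g \<circ> f) w"
  by (auto simp: map_wedge_def split: prod.splits)

lemma map_wedge_id [simp]: "map_wedge id w = w"
  by (auto simp: map_wedge_def split: prod.splits)

lemma part_equivp_wedge_iso: "part_equivp wedge_iso"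
proof (rule part_equivpI)
  have "wf_wedge (Wedge_Pres (\<lambda>_. []) {})"
    by (simp add: wf_wedge_def wf_circles_def points_def)
  then show "\<exists>W. wedge_iso W W"
    using wedge_iso_refl by blast
  show "symp wedge_iso"
  proof (rule sympI)
    fix W W' :: "'l wedge_pres"
    assume "wedge_iso W W'"
    then obtain f where f: "wf_wedge W" "wf_wedge W'" "bij f"
      "circles_iso f (wcircles W) (wcircles W')" "wedges W' = map_wedge f ` wedges W"
      unfolding wedge_iso_def by blast
    then have "map_wedge (inv f) ` wedges W' = wedges W"
      by (simp add: image_image map_wedge_comp bij_is_inj)
    with f show "wedge_iso W' W"
      unfolding wedge_iso_def
      by (intro conjI exI[of _ "inv f"]) (simp_all add: circles_iso_sym bij_imp_bij_inv)
  qed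
  show "transp wedge_iso"
  proof (rule transpI)
    fix W W' W'' :: "'l wedge_pres"
    assume "wedge_iso W W'" "wedge_iso W' W''"
    then obtain f g where fg: "wf_wedge W" "wf_wedge W''" "bij f" "bij g"
      "circles_iso f (wcircles W) (wcircles W')" "wedges W' = map_wedge f ` wedges W"
      "circles_iso g (wcircles W') (wcircles W'')" "wedges W'' = map_wedge g ` wedges W'"
      unfolding wedge_iso_def by blast
    show "wedge_iso W W''"
      unfolding wedge_iso_def
      using fg by (intro conjI exI[of _ "g \<circ> f"])
        (auto simp: bij_comp image_image map_wedge_comp intro: circles_iso_trans)
  qed
qed

quotient_type 'l wedge_diagram = "'l wedge_pres" / partial: wedge_iso
  by (rule part_equivp_wedge_iso)

section \<open>Vector spaces of diagrams\<close>

subsection \<open>Free vector spaces\<close>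

type_synonym 'd free_space = "'d \<Rightarrow>\<^sub>0 rat"

definition free_scale :: "rat \<Rightarrow> 'd free_space \<Rightarrow> 'd free_space" where
  "free_scale r = Poly_Mapping.map ((*) r)"

definition gen :: "'d \<Rightarrow> 'd free_space" where
  "gen d = Poly_Mapping.single d 1"

lemma lookup_free_scale [simp]: "Poly_Mapping.lookup (free_scale r x) d = r * Poly_Mapping.lookup x d"
  by (simp add: free_scale_def Poly_Mapping.map.rep_eq when_def)

interpretation free: vector_space free_scale
  by unfold_locales (auto intro!: poly_mapping_eqI simp: lookup_add algebra_simps)

text \<open>The linear map with prescribed values on the basis.\<close>
definition free_extend :: "('d \<Rightarrow> 'e free_space) \<Rightarrow> 'd free_space \<Rightarrow> 'e free_space" where
  "free_extend \<phi> x = (\<Sum>d\<in>Poly_Mapping.keys x. free_scale (Poly_Mapping.lookup x d) (\<phi> d))"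

lemma free_extend_superset:
  assumes "finite A" "Poly_Mapping.keys x \<subseteq> A"
  shows "free_extend \<phi> x = (\<Sum>d\<in>A. free_scale (Poly_Mapping.lookup x d) (\<phi> d))"
  unfolding free_extend_def
  using assms by (intro sum.mono_neutral_left) (auto simp: in_keys_iff)

lemma linear_free_extend: "Vector_Spaces.linear free_scale free_scale (free_extend \<phi>)"
proof (unfold_locales)
  fix x y :: "'a free_space" and r :: rat
  let ?A = "Poly_Mapping.keys x \<union> Poly_Mapping.keys y"
  have *: "finite ?A" by simp
  show "free_extend \<phi> (x + y) = free_extend \<phi> x + free_extend \<phi> y"
    using Poly_Mapping.keys_add[of x y]
    by (simp add: free_extend_superset[OF *] lookup_add free.scale_left_distrib sum.distrib)
  have "Poly_Mapping.keys (free_scale r x) \<subseteq> Poly_Mapping.keys x"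
    by (auto simp: in_keys_iff)
  then show "free_extend \<phi> (free_scale r x) = free_scale r (free_extend \<phi> x)"
    by (simp add: free_extend_superset[OF finite_keys, of "free_scale r x" x]
        free_extend_def[of _ x] free.scale_sum_right)
qed

interpretation free_ext: Vector_Spaces.linear free_scale free_scale "free_extend \<phi>" for \<phi>
  by (rule linear_free_extend)

lemma free_extend_gen [simp]: "free_extend \<phi> (gen d) = \<phi> d"
  by (simp add: free_extend_def gen_def)

subsection \<open>The space of chord diagrams modulo 4-T\<close>

text \<open>
  In the 4-T relation the end point \<open>x\<close> of a chord \<open>{x, y}\<close> is inserted right after and right before
  each of the two end points of another chord \<open>{a, b}\<close>; \<open>c\<close> describes the circles without \<open>x\<close>.
\<close>
definition chord_4T :: "('l::finite) chord_diagram free_space set" where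
  "chord_4T = {gen (abs_chord_diagram (D a [a, x])) - gen (abs_chord_diagram (D a [x, a])) +
               gen (abs_chord_diagram (D b [b, x])) - gen (abs_chord_diagram (D b [x, b])) | D c C a b x y.
     D = (\<lambda>p xs. Chord_Pres (replace_point p xs c) C) \<and>
     {a, b} \<in> C \<and> {x, y} \<in> C \<and> {a, b} \<noteq> {x, y} \<and> x \<notin> points c \<and>
     wf_chord (D a [a, x]) \<and> wf_chord (D a [x, a]) \<and> wf_chord (D b [b, x]) \<and> wf_chord (D b [x, b])}"

lemma equivp_mod_span: "equivp (\<lambda>x y. x - y \<in> free.span R)"
proof (rule equivpI)
  show "reflp (\<lambda>x y. x - y \<in> free.span R)"
    by (simp add: reflp_def free.span_zero)
  show "symp (\<lambda>x y. x - y \<in> free.span R)"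
    by (metis (mono_tags, lifting) sympI free.span_neg minus_diff_eq)
  show "transp (\<lambda>x y. x - y \<in> free.span R)"
    by (rule transpI) (metis (no_types, lifting) free.span_add diff_add_cancel add_diff_eq)
qed

lemma mod_span_add:
  "x - x' \<in> free.span R \<Longrightarrow> y - y' \<in> free.span R \<Longrightarrow> (x + y) - (x' + y') \<in> free.span R"
  by (metis free.span_add add_diff_add)

lemma mod_span_diff:
  "x - x' \<in> free.span R \<Longrightarrow> y - y' \<in> free.span R \<Longrightarrow> (x - y) - (x' - y') \<in> free.span R"
  using free.span_diff[of "x - x'" R "y - y'"] by (simp add: algebra_simps)

lemma mod_span_uminus: "x - x' \<in> free.span R \<Longrightarrow> - x - - x' \<in> free.span R"
  using mod_span_diff[of 0 0 R x x'] by (simp add: free.span_zero)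

lemma mod_span_scale:
  "x - x' \<in> free.span R \<Longrightarrow> free_scale r x - free_scale r x' \<in> free.span R"
  by (metis free.span_scale free.scale_right_diff_distrib)

quotient_type (overloaded) 'l Ac = "('l::finite) chord_diagram free_space" /
  "\<lambda>x y. x - y \<in> free.span chord_4T"
  by (rule equivp_mod_span)

instantiation Ac :: (finite) ab_group_add
begin

lift_definition zero_Ac :: "'a Ac" is 0 .
lift_definition plus_Ac :: "'a Ac \<Rightarrow> 'a Ac \<Rightarrow> 'a Ac" is "(+)" by (rule mod_span_add)
lift_definition minus_Ac :: "'a Ac \<Rightarrow> 'a Ac \<Rightarrow> 'a Ac" is "(-)" by (rule mod_span_diff)
lift_definition uminus_Ac :: "'a Ac \<Rightarrow> 'a Ac" is uminus by (rule mod_span_uminus)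

instance
  by standard (transfer; simp add: algebra_simps free.span_zero)+

end

lift_definition scale_Ac :: "rat \<Rightarrow> ('l::finite) Ac \<Rightarrow> 'l Ac" is free_scale
  by (rule mod_span_scale)

interpretation Ac: vector_space scale_Ac
  by unfold_locales
    (transfer; simp add: free.span_zero free.scale_right_distrib free.scale_left_distrib)+

subsection \<open>The space of trivalent diagrams modulo AS, STU and 4-T\<close>

definition tri_AS :: "('l::finite) trivalent_diagram free_space set" where
  "tri_AS = {gen (abs_trivalent_diagram (Tri_Pres c C V)) +
             gen (abs_trivalent_diagram (Tri_Pres c C (insert (v\<inverse>) (V - {v})))) | c C V v.
     v \<in> V \<and> wf_tri (Tri_Pres c C V) \<and> wf_tri (Tri_Pres c C (insert (v\<inverse>) (V - {v})))}"

text \<open>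
  The chord \<open>{e, h}\<close> joins the external vertex \<open>e\<close> to the internal vertex with cyclic order
  \<open>(h, p, q)\<close>.  The sign is the usual one for counterclockwise cyclic orders when the circle runs
  from left to right below the chord \<open>{e, h}\<close>: there \<open>q\<close> is the left and \<open>p\<close> the right branch, and
  the term with the branches in parallel is positive.
\<close>
definition tri_STU :: "('l::finite) trivalent_diagram free_space set" where
  "tri_STU = {gen (abs_trivalent_diagram (Tri_Pres c C V)) -
              (gen (abs_trivalent_diagram (D [q, p])) - gen (abs_trivalent_diagram (D [p, q])))
     | D c C V e h p q.
     D = (\<lambda>xs. Tri_Pres (replace_point e xs c) (C - {{e, h}}) (V - {cyc3 h p q})) \<and>
     e \<in> points c \<and> {e, h} \<in> C \<and> cyc3 h p q \<in> V \<and>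
     wf_tri (Tri_Pres c C V) \<and> wf_tri (D [q, p]) \<and> wf_tri (D [p, q])}"

definition tri_4T :: "('l::finite) trivalent_diagram free_space set" where
  "tri_4T = {gen (abs_trivalent_diagram (D a [a, x])) - gen (abs_trivalent_diagram (D a [x, a])) +
             gen (abs_trivalent_diagram (D b [b, x])) - gen (abs_trivalent_diagram (D b [x, b]))
     | D c C V a b x y.
     D = (\<lambda>p xs. Tri_Pres (replace_point p xs c) C V) \<and>
     {a, b} \<in> C \<and> {x, y} \<in> C \<and> {a, b} \<noteq> {x, y} \<and> x \<notin> points c \<and>
     {a, b, y} \<subseteq> points c \<and>
     wf_tri (D a [a, x]) \<and> wf_tri (D a [x, a]) \<and> wf_tri (D b [b, x]) \<and> wf_tri (D b [x, b])}"

quotient_type (overloaded) 'l At = "('l::finite) trivalent_diagram free_space" /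
  "\<lambda>x y. x - y \<in> free.span (tri_AS \<union> tri_STU \<union> tri_4T)"
  by (rule equivp_mod_span)

instantiation At :: (finite) ab_group_add
begin

lift_definition zero_At :: "'a At" is 0 .
lift_definition plus_At :: "'a At \<Rightarrow> 'a At \<Rightarrow> 'a At" is "(+)" by (rule mod_span_add)
lift_definition minus_At :: "'a At \<Rightarrow> 'a At \<Rightarrow> 'a At" is "(-)" by (rule mod_span_diff)
lift_definition uminus_At :: "'a At \<Rightarrow> 'a At" is uminus by (rule mod_span_uminus)

instance
  by standard (transfer; simp add: algebra_simps free.span_zero)+

end

lift_definition scale_At :: "rat \<Rightarrow> ('l::finite) At \<Rightarrow> 'l At" is free_scale
  by (rule mod_span_scale)

interpretation At: vector_space scale_At
  by unfold_locales
    (transfer; simp add: free.span_zero free.scale_right_distrib free.scale_left_distrib)+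

definition strutless_space :: "('l::finite) At set" where
  "strutless_space =
     At.span {abs_At (gen (abs_trivalent_diagram D)) | D. wf_tri D \<and> strutless D}"

subsection \<open>The map from chord diagrams to trivalent diagrams\<close>

lemma points_replace_point:
  "a \<in> points c \<Longrightarrow> points (replace_point a xs c) = (points c - {a}) \<union> set xs"
  unfolding points_def replace_point_def by (auto split: if_splits)

lemma points_replace_point_notin: "a \<notin> points c \<Longrightarrow> points (replace_point a xs c) = points c"
  unfolding points_def replace_point_def by (auto split: if_splits)

lemma chord_4T_to_tri_4T:
  assumes "r \<in> chord_4T"
  shows "free_extend (\<lambda>d. gen (trivalent_of_chord d)) r \<in> tri_4T"
proof -
  obtain D c C a b x y where r:
    "r = gen (abs_chord_diagram (D a [a, x])) - gen (abs_chord_diagram (D a [x, a])) +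
         gen (abs_chord_diagram (D b [b, x])) - gen (abs_chord_diagram (D b [x, b]))"
    and D: "D = (\<lambda>p xs. Chord_Pres (replace_point p xs c) C)"
    and C: "{a, b} \<in> C" "{x, y} \<in> C" "{a, b} \<noteq> {x, y}" "x \<notin> points c"
    and wf: "wf_chord (D a [a, x])" "wf_chord (D a [x, a])" "wf_chord (D b [b, x])" "wf_chord (D b [x, b])"
    using assms unfolding chord_4T_def mem_Collect_eq by (elim exE conjE) (rule that)
  have part: "partition_on (points (replace_point a [a, x] c)) C" "\<forall>c\<in>C. card c = 2"
    using wf(1) by (simp_all add: wf_chord_def D)
  have "{a, b} \<inter> {x, y} = {}"
    using part(1) C by (metis disjointD partition_onD2)
  moreover have "a \<noteq> b" "x \<noteq> y"
    using part(2) C by fastforce+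
  moreover have "{a, b, x, y} \<subseteq> points (replace_point a [a, x] c)"
    using partition_onD1[OF part(1)] C by auto
  moreover have "a \<in> points c"
    using calculation C points_replace_point_notin by force
  ultimately have "{a, b, y} \<subseteq> points c"
    using points_replace_point[of a c "[a, x]"] by auto
  moreover have "trivalent_of_chord (abs_chord_diagram E) = abs_trivalent_diagram (chord_to_tri E)"
    if "wf_chord E" for E :: "'a chord_pres"
    using that by (simp add: trivalent_of_chord.abs_eq chord_iso_refl)
  moreover define T where "T = (\<lambda>p xs. Tri_Pres (replace_point p xs c) C ({} :: nat rel set))"
  have T: "chord_to_tri (D p xs) = T p xs" for p xs
    by (simp add: chord_to_tri_def D T_def)
  ultimately have "free_extend (\<lambda>d. gen (trivalent_of_chord d)) r =
      gen (abs_trivalent_diagram (T a [a, x])) - gen (abs_trivalent_diagram (T a [x, a])) +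
      gen (abs_trivalent_diagram (T b [b, x])) - gen (abs_trivalent_diagram (T b [x, b]))"
    using wf by (simp add: r free_ext.add free_ext.diff)
  moreover have "wf_tri (T a [a, x])" "wf_tri (T a [x, a])" "wf_tri (T b [b, x])" "wf_tri (T b [x, b])"
    using wf wf_chord_to_tri T by metis+
  ultimately show ?thesis
    unfolding tri_4T_def mem_Collect_eq
    using C T_def \<open>{a, b, y} \<subseteq> points c\<close> by (intro exI conjI)
qed

text \<open>The map \<open>A\<^sup>c \<rightarrow> A\<^sup>t\<close> induced by the inclusion of chord diagrams into trivalent diagrams.\<close>
lift_definition At_of_Ac :: "('l::finite) Ac \<Rightarrow> 'l At"
  is "free_extend (\<lambda>d. gen (trivalent_of_chord d))"
proof -
  fix x y :: "'l chord_diagram free_space"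
  let ?F = "free_extend (\<lambda>d. gen (trivalent_of_chord d))"
  assume "x - y \<in> free.span chord_4T"
  then have "?F (x - y) \<in> ?F ` free.span chord_4T" by blast
  also have "\<dots> = free.span (?F ` chord_4T)" by (simp add: free_ext.span_image)
  also have "\<dots> \<subseteq> free.span (tri_AS \<union> tri_STU \<union> tri_4T)"
    using chord_4T_to_tri_4T by (intro free.span_mono) blast
  finally show "?F x - ?F y \<in> free.span (tri_AS \<union> tri_STU \<union> tri_4T)"
    by (simp add: free_ext.diff)
qed

section \<open>The map \<open>\<iota>\<close>\<close>

text \<open>The chord diagram in which the legs \<open>-\<close> of the wedges in \<open>S\<close> and \<open>+\<close> of the others are kept.\<close>
definition keep_legs :: "'l wedge_pres \<Rightarrow> wedge set \<Rightarrow> 'l chord_pres" where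
  "keep_legs W S =
     (let C = (\<lambda>(t, p, m). {t, if (t, p, m) \<in> S then m else p}) ` wedges W
      in Chord_Pres (\<lambda>i. filter (\<lambda>x. x \<in> \<Union>C) (wcircles W i)) C)"

lemma wf_keep_legs:
  assumes "wf_wedge W"
  shows "wf_chord (keep_legs W S)"
proof -
  define g where "g = (\<lambda>(t, p, m). {t, if (t, p, m) \<in> S then m else p :: nat})"
  define C where "C = g ` wedges W"
  have sub: "g w \<subseteq> wedge_points w" for w
    by (auto simp: g_def wedge_points_def split: prod.splits)
  have "\<Union>C \<subseteq> points (wcircles W)"
    using assms sub unfolding wf_wedge_def C_def by blast
  then have 1: "points (\<lambda>i. filter (\<lambda>x. x \<in> \<Union>C) (wcircles W i)) = \<Union>C"
    unfolding points_def by auto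
  have 2: "disjoint C"
  proof (rule disjointI)
    fix c d assume "c \<in> C" "d \<in> C" "c \<noteq> d"
    then obtain w w' where w: "w \<in> wedges W" "w' \<in> wedges W" "w \<noteq> w'" "c = g w" "d = g w'"
      unfolding C_def by blast
    then have "wedge_points w \<inter> wedge_points w' = {}"
      using assms unfolding wf_wedge_def by blast
    then show "c \<inter> d = {}" using w sub by blast
  qed
  have 3: "\<forall>c\<in>C. card c = 2"
    using assms unfolding wf_wedge_def C_def g_def by fastforce
  then have "{} \<notin> C" by force
  moreover have "wf_circles (\<lambda>i. filter (\<lambda>x. x \<in> \<Union>C) (wcircles W i))"
    using assms unfolding wf_wedge_def wf_circles_def by fastforce
  ultimately have "wf_chord (Chord_Pres (\<lambda>i. filter (\<lambda>x. x \<in> \<Union>C) (wcircles W i)) C)"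
    using 1 2 3 by (simp add: wf_chord_def partition_on_def)
  then show ?thesis
    by (simp add: keep_legs_def Let_def C_def g_def)
qed

lemma inj_map_wedge: "bij f \<Longrightarrow> inj (map_wedge f)"
  by (auto simp: inj_def map_wedge_def bij_def)

lemma keep_legs_iso:
  assumes "wf_wedge W" "wf_wedge W'" "bij f" "circles_iso f (wcircles W) (wcircles W')"
    and W': "wedges W' = map_wedge f ` wedges W"
  shows "chord_iso (keep_legs W S) (keep_legs W' (map_wedge f ` S))"
proof -
  define g where "g = (\<lambda>S (t, p, m). {t, if (t, p, m) \<in> S then m else p :: nat})"
  have keep: "keep_legs V S = Chord_Pres (\<lambda>i. filter (\<lambda>x. x \<in> \<Union>(g S ` wedges V)) (wcircles V i)) (g S ` wedges V)"
    for V :: "'a wedge_pres" and S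
    by (simp add: keep_legs_def Let_def g_def)
  have "g (map_wedge f ` S) (map_wedge f w) = f ` g S w" for w
  proof -
    have "map_wedge f w \<in> map_wedge f ` S \<longleftrightarrow> w \<in> S"
      using inj_map_wedge[OF assms(3)] by (simp add: inj_image_mem_iff)
    then show ?thesis
      by (cases w) (simp add: g_def map_wedge_def)
  qed
  then have C: "g (map_wedge f ` S) ` wedges W' = (\<lambda>c. f ` c) ` g S ` wedges W"
    by (auto simp: W' image_image)
  have "circles_iso f (ccircles (keep_legs W S)) (ccircles (keep_legs W' (map_wedge f ` S)))"
    unfolding circles_iso_def
  proof
    fix i
    let ?P = "\<lambda>x. x \<in> \<Union>(g (map_wedge f ` S) ` wedges W')"
    obtain k where k: "wcircles W' i = rotate k (map f (wcircles W i))"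
      using assms(4) unfolding circles_iso_def by blast
    obtain k' where "filter ?P (rotate k (map f (wcircles W i))) = rotate k' (filter ?P (map f (wcircles W i)))"
      using filter_rotate by blast
    moreover have "?P \<circ> f = (\<lambda>x. x \<in> \<Union>(g S ` wedges W))"
      unfolding C using assms(3) by (auto simp: fun_eq_iff bij_def inj_image_mem_iff inj_eq)
    ultimately show "\<exists>k. ccircles (keep_legs W' (map_wedge f ` S)) i =
        rotate k (map f (ccircles (keep_legs W S) i))"
      by (auto simp: keep k filter_map)
  qed
  moreover have "cchords (keep_legs W' (map_wedge f ` S)) = (\<lambda>c. f ` c) ` cchords (keep_legs W S)"
    by (simp only: keep C chord_pres.sel)
  ultimately show ?thesis
    unfolding chord_iso_def using assms(1-3) wf_keep_legs by blast
qed

lift_definition resolve :: "('l::finite) wedge_diagram \<Rightarrow> 'l chord_diagram free_space"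
  is "\<lambda>W. \<Sum>S\<in>Pow (wedges W). free_scale ((-1) ^ card S) (gen (abs_chord_diagram (keep_legs W S)))"
proof -
  fix W W' :: "'l wedge_pres"
  assume "wedge_iso W W'"
  then obtain f where f: "wf_wedge W" "wf_wedge W'" "bij f"
    "circles_iso f (wcircles W) (wcircles W')" "wedges W' = map_wedge f ` wedges W"
    unfolding wedge_iso_def by blast
  have inj: "inj (map_wedge f)" by (rule inj_map_wedge[OF f(3)])
  have Pow: "Pow (wedges W') = (`) (map_wedge f) ` Pow (wedges W)"
    by (simp add: f(5) image_Pow_surj)
  have "card (map_wedge f ` S) = card S" for S
    using inj by (intro card_image) (auto simp: inj_on_def)
  moreover have "abs_chord_diagram (keep_legs W' (map_wedge f ` S)) = abs_chord_diagram (keep_legs W S)" for S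
    using keep_legs_iso[OF f] Quotient3_rel_abs[OF Quotient3_chord_diagram] by metis
  moreover have "inj_on ((`) (map_wedge f)) (Pow (wedges W))"
    using inj by (simp add: inj_on_def inj_image_eq_iff)
  ultimately show "(\<Sum>S\<in>Pow (wedges W). free_scale ((-1) ^ card S) (gen (abs_chord_diagram (keep_legs W S)))) =
      (\<Sum>S\<in>Pow (wedges W'). free_scale ((-1) ^ card S) (gen (abs_chord_diagram (keep_legs W' S))))"
    by (simp add: Pow sum.reindex)
qed

definition iota :: "('l::finite) wedge_diagram free_space \<Rightarrow> 'l Ac" where
  "iota x = abs_Ac (free_extend resolve x)"

lemma linear_iota: "Vector_Spaces.linear free_scale scale_Ac iota"
  by unfold_locales
    (simp_all add: iota_def free_ext.add free_ext.scale plus_Ac.abs_eq scale_Ac.abs_eq)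

lemma linear_At_of_Ac: "Vector_Spaces.linear scale_Ac scale_At At_of_Ac"
  by unfold_locales
    (transfer; simp add: free_ext.add free_ext.scale free.span_zero)+

lemma iota_gen:
  assumes "wf_wedge W"
  shows "iota (gen (abs_wedge_diagram W)) =
    (\<Sum>S\<in>Pow (wedges W). scale_Ac ((-1) ^ card S) (abs_Ac (gen (abs_chord_diagram (keep_legs W S)))))"
proof -
  have "abs_Ac (\<Sum>S\<in>A. F S) = (\<Sum>S\<in>A. abs_Ac (F S))"
    for A :: "wedge set set" and F :: "wedge set \<Rightarrow> 'a chord_diagram free_space"
    by (induction A rule: infinite_finite_induct) (simp_all add: zero_Ac_def plus_Ac.abs_eq[symmetric])
  then show ?thesis
    using assms by (simp add: iota_def resolve.abs_eq wedge_iso_refl scale_Ac.abs_eq)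
qed

end

theory Submission
  imports Defs "HOL-Combinatorics.Transposition"
begin

text \<open>
  Trivalent diagrams and wedge diagrams are special cases of mixed diagrams, trivalent diagrams with
  additional wedges, whose classes are the alternating sums over the choices of legs.  STU holds for
  these sums as long as no wedge ends at the three points involved.

  A mixed diagram without struts has its class in the strutless space, by induction on the number of
  wedges: slide one leg of a wedge along the circle until it is adjacent to the other leg, where the
  two choices cancel.  Passing a point \<open>x\<close> is an STU relation, which ties the wedge to the chord
  at \<open>x\<close> by a new trivalent vertex.  If \<open>x\<close> belongs to another wedge, that wedge is resolved first;
  its chord at \<open>x\<close> is no strut in the result either.

  Conversely, the class of a mixed diagram without struts is in the image of \<open>\<iota>\<close>, by induction on
  the number of internal vertices: resolving a vertex next to a circle by STU can create struts only
  at the two new external vertices, and a difference of diagrams in which the end of a strut lies on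
  either side of a point is a diagram with that strut replaced by a wedge.
\<close>

section \<open>Well-formedness of the dashed graph\<close>

definition half_edges :: "nat rel set \<Rightarrow> nat set" where
  "half_edges V = (\<Union>v\<in>V. Field v)"

definition adj :: "nat set set \<Rightarrow> nat rel set \<Rightarrow> nat rel" where
  "adj C V = {(h, h'). \<exists>c\<in>C. h \<in> c \<and> h' \<in> c} \<union> \<Union>V"

text \<open>Apart from \<open>wf_circles\<close>, well-formedness of a trivalent diagram sees the
  circles only through the set \<open>P\<close> of external vertices. Isolating this part lets moves
  on the graph be checked without lists of points.\<close>

definition wf_graph :: "nat set \<Rightarrow> nat set set \<Rightarrow> nat rel set \<Rightarrow> bool" where
  "wf_graph P C V \<longleftrightarrow> finite V \<and>
     (\<forall>v\<in>V. \<exists>x y z. distinct [x, y, z] \<and> v = cyc3 x y z) \<and>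
     (\<forall>v\<in>V. \<forall>w\<in>V. v \<noteq> w \<longrightarrow> Field v \<inter> Field w = {}) \<and>
     P \<inter> half_edges V = {} \<and>
     partition_on (P \<union> half_edges V) C \<and>
     (\<forall>c\<in>C. card c = 2) \<and>
     (\<forall>h \<in> P \<union> half_edges V. \<exists>e\<in>P. (h, e) \<in> (adj C V)\<^sup>*)"

lemma wf_tri_iff: "wf_tri (Tri_Pres c C V) \<longleftrightarrow> wf_circles c \<and> wf_graph (points c) C V"
  unfolding wf_tri_def wf_graph_def external_def internal_def half_edges_def adjacency_def adj_def
  by simp

lemma Field_cyc3 [simp]: "Field (cyc3 x y z) = {x, y, z}"
  by (auto simp: cyc3_def Field_def)

lemma half_edges_insert [simp]: "half_edges (insert v V) = Field v \<union> half_edges V"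
  by (simp add: half_edges_def)

lemma half_edges_empty [simp]: "half_edges {} = {}"
  by (simp add: half_edges_def)

lemma adj_chord: "c \<in> C \<Longrightarrow> x \<in> c \<Longrightarrow> y \<in> c \<Longrightarrow> (x, y) \<in> adj C V"
  unfolding adj_def by blast

lemma adj_vertex: "v \<in> V \<Longrightarrow> (x, y) \<in> v \<Longrightarrow> (x, y) \<in> adj C V"
  unfolding adj_def by blast

lemma adjE:
  assumes "(x, y) \<in> adj C V"
  obtains c where "c \<in> C" "x \<in> c" "y \<in> c" | v where "v \<in> V" "(x, y) \<in> v" "x \<in> Field v" "y \<in> Field v"
  using assms unfolding adj_def by (auto intro: FieldI1 FieldI2)

lemma adj_mono: "C \<subseteq> C' \<Longrightarrow> V \<subseteq> V' \<Longrightarrow> adj C V \<subseteq> adj C' V'"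
  unfolding adj_def by blast

lemma wf_graph_Union: "wf_graph P C V \<Longrightarrow> \<Union>C = P \<union> half_edges V"
  by (simp add: wf_graph_def partition_on_def)

lemma wf_graph_chord_eq:
  assumes "wf_graph P C V" "A \<in> C" "B \<in> C" "x \<in> A" "x \<in> B"
  shows "A = B"
proof -
  have "disjoint C" using assms(1) by (simp add: wf_graph_def partition_on_def)
  then show ?thesis using assms unfolding disjoint_def by blast
qed

lemma wf_graph_chordE:
  assumes "wf_graph P C V" "A \<in> C" "x \<in> A"
  obtains y where "A = {x, y}" "x \<noteq> y"
proof -
  have "card A = 2" using assms by (simp add: wf_graph_def)
  then obtain a b where "A = {a, b}" "a \<noteq> b" by (meson card_2_iff)
  then show ?thesis using that assms(3) by (metis insertE insert_commute singletonD)
qed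

lemma finite_half_edges: "wf_graph P C V \<Longrightarrow> finite (half_edges V)"
  unfolding half_edges_def wf_graph_def by (auto simp: cyc3_def Field_def)

text \<open>A strut is a whole component of the dashed graph and has external ends, so it neither
  creates nor destroys connections in the rest of the graph.\<close>

lemma wf_graph_insert_strut:
  assumes "t \<noteq> p" "{t, p} \<inter> (P \<union> half_edges V) = {}" "{t, p} \<inter> \<Union>C = {}"
  shows "wf_graph (insert t (insert p P)) (insert {t, p} C) V \<longleftrightarrow> wf_graph P C V"
proof -
  let ?C = "insert {t, p} C" and ?P = "insert t (insert p P)"
  have part: "partition_on (?P \<union> half_edges V) ?C \<longleftrightarrow> partition_on (P \<union> half_edges V) C"
  proof -
    have "?P \<union> half_edges V - {t, p} = P \<union> half_edges V" using assms(2) by blast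
    then show ?thesis
      using partition_on_insert[of "{t, p}" C "?P \<union> half_edges V"] assms(3) by (auto simp: disjnt_def)
  qed
  have conn: "(\<forall>h \<in> ?P \<union> half_edges V. \<exists>e\<in>?P. (h, e) \<in> (adj ?C V)\<^sup>*) \<longleftrightarrow>
      (\<forall>h \<in> P \<union> half_edges V. \<exists>e\<in>P. (h, e) \<in> (adj C V)\<^sup>*)"
  proof
    assume old: "\<forall>h \<in> P \<union> half_edges V. \<exists>e\<in>P. (h, e) \<in> (adj C V)\<^sup>*"
    have "(adj C V)\<^sup>* \<subseteq> (adj ?C V)\<^sup>*" by (intro rtrancl_mono adj_mono) auto
    then show "\<forall>h \<in> ?P \<union> half_edges V. \<exists>e\<in>?P. (h, e) \<in> (adj ?C V)\<^sup>*"
      using old by blast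
  next
    assume new: "\<forall>h \<in> ?P \<union> half_edges V. \<exists>e\<in>?P. (h, e) \<in> (adj ?C V)\<^sup>*"
    \<comment> \<open>No edge joins \<open>t\<close> or \<open>p\<close> to another half-edge, so a
      path that starts outside the strut never enters it.\<close>
    have path: "x \<notin> {t, p} \<longrightarrow> y \<notin> {t, p} \<and> (x, y) \<in> (adj C V)\<^sup>*"
      if "(x, y) \<in> (adj ?C V)\<^sup>*" for x y
      using that
    proof (induction rule: converse_rtrancl_induct)
      case base
      then show ?case by blast
    next
      case (step x z)
      show ?case
      proof
        assume x: "x \<notin> {t, p}"
        from step(1) have "(x, z) \<in> adj C V \<and> z \<notin> {t, p}"
        proof (cases rule: adjE)
          case (1 c)
          then have "c \<in> C" using x by blast
          then show ?thesis using 1 assms(3) adj_chord[of c C x z V] by blast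
        next
          case (2 v)
          then show ?thesis using assms(2) adj_vertex[of v V x z C] unfolding half_edges_def by blast
        qed
        then show "y \<notin> {t, p} \<and> (x, y) \<in> (adj C V)\<^sup>*"
          using step.IH by (meson converse_rtrancl_into_rtrancl)
      qed
    qed
    show "\<forall>h \<in> P \<union> half_edges V. \<exists>e\<in>P. (h, e) \<in> (adj C V)\<^sup>*"
      using new path assms(2) by blast
  qed
  have "card {t, p} = 2" "?P \<inter> half_edges V = {} \<longleftrightarrow> P \<inter> half_edges V = {}"
    using assms by auto
  then show ?thesis
    unfolding wf_graph_def part conn by simp
qed

text \<open>Removing the chord \<open>{e, h}\<close> and the vertex makes \<open>p\<close> and
  \<open>q\<close> external under their old labels, so the other chords are untouched. Connectedness
  carries over: \<open>p\<close> and \<open>q\<close> reach \<open>e\<close> through the vertex, and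
  any path to \<open>e\<close> from outside \<open>{e, h}\<close> meets \<open>p\<close> or
  \<open>q\<close>.\<close>

lemma wf_graph_STU:
  assumes "distinct [e, h, p, q]" "{e, h, p, q} \<inter> (P \<union> half_edges V) = {}" "{e, h} \<inter> \<Union>C = {}"
  shows "wf_graph (insert e P) (insert {e, h} C) (insert (cyc3 h p q) V) \<longleftrightarrow>
    wf_graph (insert p (insert q P)) C V"
proof -
  let ?C = "insert {e, h} C" and ?V = "insert (cyc3 h p q) V" and ?P = "insert p (insert q P)"
  let ?U = "insert e P \<union> half_edges ?V" and ?U' = "?P \<union> half_edges V"
  have part: "partition_on ?U ?C \<longleftrightarrow> partition_on ?U' C"
  proof -
    have "?U - {e, h} = ?U'" using assms(1,2) by auto
    moreover have "disjnt {e, h} (\<Union>C)" using assms(3) by (simp add: disjnt_def)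
    ultimately show ?thesis
      by (simp only: partition_on_insert) simp
  qed
  have conn: "(\<forall>x \<in> ?U. \<exists>y\<in>insert e P. (x, y) \<in> (adj ?C ?V)\<^sup>*) \<longleftrightarrow>
      (\<forall>x \<in> ?U'. \<exists>y\<in>?P. (x, y) \<in> (adj C V)\<^sup>*)"
  proof
    assume old: "\<forall>x \<in> ?U'. \<exists>y\<in>?P. (x, y) \<in> (adj C V)\<^sup>*"
    have sub: "(adj C V)\<^sup>* \<subseteq> (adj ?C ?V)\<^sup>*" by (intro rtrancl_mono adj_mono) auto
    have he: "(h, e) \<in> adj ?C ?V" by (rule adj_chord[of "{e, h}"]) auto
    moreover have "(q, h) \<in> adj ?C ?V" "(p, q) \<in> adj ?C ?V"
      by (auto intro!: adj_vertex[of "cyc3 h p q"] simp: cyc3_def)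
    ultimately have qe: "(q, e) \<in> (adj ?C ?V)\<^sup>*" and pe: "(p, e) \<in> (adj ?C ?V)\<^sup>*"
      by (meson converse_rtrancl_into_rtrancl rtrancl.rtrancl_refl)+
    show "\<forall>x \<in> ?U. \<exists>y\<in>insert e P. (x, y) \<in> (adj ?C ?V)\<^sup>*"
    proof
      fix x assume "x \<in> ?U"
      then consider "x = e" | "x = h" | "x \<in> ?U'" by auto
      then show "\<exists>y\<in>insert e P. (x, y) \<in> (adj ?C ?V)\<^sup>*"
      proof cases
        case 3
        then obtain y where "y \<in> ?P" "(x, y) \<in> (adj ?C ?V)\<^sup>*"
          using old sub by blast
        then show ?thesis using qe pe by (metis insert_iff rtrancl_trans)
      qed (use he in blast)+
    qed
  next
    assume new: "\<forall>x \<in> ?U. \<exists>y\<in>insert e P. (x, y) \<in> (adj ?C ?V)\<^sup>*"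
    \<comment> \<open>A path is cut where it first meets \<open>p\<close> or \<open>q\<close>, which
      are external in the resolved graph; up to there it uses only edges of \<open>C\<close> and
      \<open>V\<close>.\<close>
    have path: "x \<in> {e, h} \<or> (\<exists>y\<in>?P. (x, y) \<in> (adj C V)\<^sup>*)"
      if "(x, y) \<in> (adj ?C ?V)\<^sup>*" "y \<in> insert e P" for x y
      using that
    proof (induction rule: converse_rtrancl_induct)
      case base
      then show ?case by blast
    next
      case (step x z)
      show ?case
      proof (cases "x \<in> {e, h, p, q}")
        case True
        then show ?thesis by blast
      next
        case False
        from step(1) have "(x, z) \<in> adj C V \<and> z \<notin> {e, h}"
        proof (cases rule: adjE)
          case (1 c)
          then have "c \<in> C" using False by blast
          then show ?thesis using 1 assms(3) adj_chord[of c C x z V] by blast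
        next
          case (2 v)
          then have "v \<in> V" using False by auto
          then show ?thesis using 2 assms(2) adj_vertex[of v V x z C] unfolding half_edges_def by blast
        qed
        then show ?thesis
          using step.IH step.prems by (meson converse_rtrancl_into_rtrancl)
      qed
    qed
    show "\<forall>x \<in> ?U'. \<exists>y\<in>?P. (x, y) \<in> (adj C V)\<^sup>*"
    proof
      fix x assume "x \<in> ?U'"
      then have "x \<in> ?U" "x \<notin> {e, h}" using assms(1,2) by auto
      then show "\<exists>y\<in>?P. (x, y) \<in> (adj C V)\<^sup>*"
        using new path by blast
    qed
  qed
  have disj: "Field v \<inter> {h, p, q} = {}" if "v \<in> V" for v
    using that assms(2) unfolding half_edges_def by blast
  have "cyc3 h p q \<notin> V"
    using disj by force
  then have verts: "(\<forall>v\<in>?V. \<forall>w\<in>?V. v \<noteq> w \<longrightarrow> Field v \<inter> Field w = {}) \<longleftrightarrow>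
      (\<forall>v\<in>V. \<forall>w\<in>V. v \<noteq> w \<longrightarrow> Field v \<inter> Field w = {})"
    using disj by (auto 0 3)
  have ext: "insert e P \<inter> half_edges ?V = {} \<longleftrightarrow> ?P \<inter> half_edges V = {}"
    using assms(1,2) by auto
  have cyc: "\<exists>x y z. distinct [x, y, z] \<and> cyc3 h p q = cyc3 x y z"
    using assms(1) by (intro exI[of _ h] exI[of _ p] exI[of _ q]) simp
  have "card {e, h} = 2" using assms(1) by simp
  then show ?thesis
    unfolding wf_graph_def part conn verts ext using cyc by simp
qed

section \<open>Trivalent diagrams with wedges\<close>

definition drop_points :: "nat set \<Rightarrow> 'l circles \<Rightarrow> 'l circles" where
  "drop_points A c = (\<lambda>i. filter (\<lambda>x. x \<notin> A) (c i))"

lemma set_drop_points [simp]: "set (drop_points A c i) = set (c i) - A"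
  by (auto simp: drop_points_def)

lemma points_drop_points [simp]: "points (drop_points A c) = points c - A"
  by (auto simp: points_def)

lemma drop_points_empty [simp]: "drop_points {} c = c"
  by (simp add: drop_points_def)

lemma drop_points_drop_points [simp]: "drop_points A (drop_points B c) = drop_points (A \<union> B) c"
  by (auto simp: drop_points_def intro!: filter_cong)

lemma wf_circles_drop_points: "wf_circles c \<Longrightarrow> wf_circles (drop_points A c)"
  unfolding wf_circles_def by (auto simp: drop_points_def)

lemma drop_points_upd:
  "drop_points A (c(i := xs)) = (drop_points A c)(i := filter (\<lambda>x. x \<notin> A) xs)"
  by (auto simp: drop_points_def)

lemma finite_points: "finite (points (c :: ('l::finite) circles))"
  by (simp add: points_def)

definition wedge_support :: "wedge set \<Rightarrow> nat set" where
  "wedge_support W = (\<Union>w\<in>W. wedge_points w)"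

lemma wedge_support_insert [simp]: "wedge_support (insert (t, p, m) W) = {t, p, m} \<union> wedge_support W"
  by (simp add: wedge_support_def wedge_points_def)

lemma wedge_support_empty [simp]: "wedge_support {} = {}"
  by (simp add: wedge_support_def)

lemma wedge_points_simp [simp]: "wedge_points (t, p, m) = {t, p, m}"
  by (simp add: wedge_points_def)

text \<open>
  The tips and legs of the wedges \<open>W\<close> are points of \<open>c\<close> that meet neither \<open>C\<close> nor \<open>V\<close>, which form a
  trivalent diagram on the remaining points.
\<close>
definition wf_mixed :: "'l circles \<Rightarrow> nat set set \<Rightarrow> nat rel set \<Rightarrow> wedge set \<Rightarrow> bool" where
  "wf_mixed c C V W \<longleftrightarrow> wf_circles c \<and> finite W \<and>
     (\<forall>(t, p, m)\<in>W. distinct [t, p, m] \<and> (\<exists>i. {p, m} \<subseteq> set (c i))) \<and>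
     (\<forall>w\<in>W. \<forall>w'\<in>W. w \<noteq> w' \<longrightarrow> wedge_points w \<inter> wedge_points w' = {}) \<and>
     wedge_support W \<subseteq> points c \<and> wedge_support W \<inter> half_edges V = {} \<and>
     wf_graph (points c - wedge_support W) C V"

lemma wf_mixedI:
  assumes "wf_circles c" "finite W" "\<And>t p m. (t, p, m) \<in> W \<Longrightarrow> distinct [t, p, m]"
    and "\<And>t p m. (t, p, m) \<in> W \<Longrightarrow> \<exists>i. {p, m} \<subseteq> set (c i)"
    and "\<And>w w'. w \<in> W \<Longrightarrow> w' \<in> W \<Longrightarrow> w \<noteq> w' \<Longrightarrow> wedge_points w \<inter> wedge_points w' = {}"
    and "wedge_support W \<subseteq> points c" "wedge_support W \<inter> half_edges V = {}"
    and "wf_graph (points c - wedge_support W) C V"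
  shows "wf_mixed c C V W"
  using assms unfolding wf_mixed_def by blast

lemma wf_mixedD:
  assumes "wf_mixed c C V W"
  shows wf_mixed_circles: "wf_circles c" and wf_mixed_finite: "finite W"
    and wf_mixed_distinct: "\<And>t p m. (t, p, m) \<in> W \<Longrightarrow> distinct [t, p, m]"
    and wf_mixed_legs: "\<And>t p m. (t, p, m) \<in> W \<Longrightarrow> \<exists>i. {p, m} \<subseteq> set (c i)"
    and wf_mixed_disjoint: "\<And>w w'. w \<in> W \<Longrightarrow> w' \<in> W \<Longrightarrow> w \<noteq> w' \<Longrightarrow>
      wedge_points w \<inter> wedge_points w' = {}"
    and wf_mixed_support: "wedge_support W \<subseteq> points c" "wedge_support W \<inter> half_edges V = {}"
    and wf_mixed_graph: "wf_graph (points c - wedge_support W) C V"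
  using assms unfolding wf_mixed_def by blast+

definition leg_chord :: "wedge set \<Rightarrow> wedge \<Rightarrow> nat set" where
  "leg_chord S = (\<lambda>(t, p, m). {t, if (t, p, m) \<in> S then m else p})"

definition lost_leg :: "wedge set \<Rightarrow> wedge \<Rightarrow> nat" where
  "lost_leg S = (\<lambda>(t, p, m). if (t, p, m) \<in> S then p else m)"

definition mixed_resolution ::
    "'l circles \<Rightarrow> nat set set \<Rightarrow> nat rel set \<Rightarrow> wedge set \<Rightarrow> wedge set \<Rightarrow> 'l tri_pres" where
  "mixed_resolution c C V W S = Tri_Pres (drop_points (lost_leg S ` W) c) (leg_chord S ` W \<union> C) V"

definition diagram_class :: "('l::finite) tri_pres \<Rightarrow> 'l At" where
  "diagram_class D = abs_At (gen (abs_trivalent_diagram D))"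

text \<open>Interpolates between the two sides of the theorem: without wedges it is the class of a
  trivalent diagram, and for empty \<open>C\<close> and \<open>V\<close> it is the image of a wedge
  diagram under \<open>iota\<close>.\<close>

definition mixed_sum ::
    "('l::finite) circles \<Rightarrow> nat set set \<Rightarrow> nat rel set \<Rightarrow> wedge set \<Rightarrow> 'l At" where
  "mixed_sum c C V W =
     (\<Sum>S\<in>Pow W. scale_At ((-1) ^ card S) (diagram_class (mixed_resolution c C V W S)))"

lemma mixed_sum_empty [simp]: "mixed_sum c C V {} = diagram_class (Tri_Pres c C V)"
  by (simp add: mixed_sum_def mixed_resolution_def)

lemma mixed_resolution_insert:
  "mixed_resolution c C V (insert (t, p, m) W) S =
    (if (t, p, m) \<in> S then mixed_resolution (drop_points {p} c) (insert {t, m} C) V W S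
     else mixed_resolution (drop_points {m} c) (insert {t, p} C) V W S)"
  by (simp add: mixed_resolution_def lost_leg_def leg_chord_def)

lemma mixed_resolution_cong:
  assumes "S \<inter> W = S' \<inter> W"
  shows "mixed_resolution c C V W S = mixed_resolution c C V W S'"
proof -
  have "w \<in> S \<longleftrightarrow> w \<in> S'" if "w \<in> W" for w using that assms by blast
  then have "lost_leg S ` W = lost_leg S' ` W" "leg_chord S ` W = leg_chord S' ` W"
    by (auto simp: lost_leg_def leg_chord_def intro!: image_cong)
  then show ?thesis by (simp add: mixed_resolution_def)
qed

text \<open>The choices of legs are split by the leg kept on \<open>(t, p, m)\<close>. This
  recursion trades one wedge for a strut in each of two terms, so that wedges can be treated one at
  a time.\<close>

lemma mixed_sum_insert:
  assumes "finite W" "(t, p, m) \<notin> W"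
  shows "mixed_sum c C V (insert (t, p, m) W) =
    mixed_sum (drop_points {m} c) (insert {t, p} C) V W -
    mixed_sum (drop_points {p} c) (insert {t, m} C) V W"
proof -
  let ?w = "(t, p, m)"
  let ?f = "\<lambda>S. scale_At ((-1) ^ card S) (diagram_class (mixed_resolution c C V (insert ?w W) S))"
  have inj: "inj_on (insert ?w) (Pow W)"
    using assms(2) by (intro inj_onI) (metis PowD insert_ident subsetD)
  have "sum ?f (Pow (insert ?w W)) = sum ?f (Pow W) + sum ?f (insert ?w ` Pow W)"
    using assms by (subst Pow_insert) (auto intro!: sum.union_disjoint)
  also have "sum ?f (Pow W) = mixed_sum (drop_points {m} c) (insert {t, p} C) V W"
    unfolding mixed_sum_def
    using assms(2) by (intro sum.cong) (auto simp: mixed_resolution_insert)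
  also have "sum ?f (insert ?w ` Pow W) = (\<Sum>S\<in>Pow W. ?f (insert ?w S))"
    using inj by (rule sum.reindex_cong) simp_all
  \<comment> \<open>Adding the wedge to \<open>S\<close> raises the cardinality by one, whence the
    sign, and leaves the legs kept on \<open>W\<close> as they were.\<close>
  also have "\<dots> = (\<Sum>S\<in>Pow W. - scale_At ((-1) ^ card S)
      (diagram_class (mixed_resolution (drop_points {p} c) (insert {t, m} C) V W S)))"
  proof (rule sum.cong)
    fix S assume "S \<in> Pow W"
    then have "card (insert ?w S) = Suc (card S)"
      using assms finite_subset[of S W] by (auto intro: card_insert_disjoint)
    moreover have "mixed_resolution (drop_points {p} c) (insert {t, m} C) V W (insert ?w S) =
        mixed_resolution (drop_points {p} c) (insert {t, m} C) V W S"
      using assms(2) by (intro mixed_resolution_cong) auto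
    ultimately show "?f (insert ?w S) = - scale_At ((-1) ^ card S)
        (diagram_class (mixed_resolution (drop_points {p} c) (insert {t, m} C) V W S))"
      by (simp add: mixed_resolution_insert)
  qed simp
  also have "\<dots> = - mixed_sum (drop_points {p} c) (insert {t, m} C) V W"
    by (simp add: mixed_sum_def sum_negf)
  finally show ?thesis
    by (simp add: mixed_sum_def)
qed

lemma mixed_sum_swap_legs:
  assumes "finite W" "(t, p, m) \<notin> W" "(t, m, p) \<notin> W"
  shows "mixed_sum c C V (insert (t, m, p) W) = - mixed_sum c C V (insert (t, p, m) W)"
  using assms by (simp add: mixed_sum_insert)

lemma wf_mixed_Union:
  "wf_mixed c C V W \<Longrightarrow> \<Union>C = points c - wedge_support W \<union> half_edges V"
  by (simp add: wf_mixed_def wf_graph_Union)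

lemma wf_mixed_insert_disjoint:
  assumes "wf_mixed c C V (insert (t, p, m) W)" "(t, p, m) \<notin> W"
  shows "{t, p, m} \<inter> wedge_support W = {}"
proof -
  have "wedge_points (t, p, m) \<inter> wedge_points w = {}" if "w \<in> W" for w
    using assms that by (intro wf_mixed_disjoint[OF assms(1)]) auto
  then show ?thesis
    unfolding wedge_support_def wedge_points_simp by blast
qed

lemma wf_mixed_swap_legs:
  assumes "wf_mixed c C V (insert (t, p, m) W)" "(t, p, m) \<notin> W"
  shows "wf_mixed c C V (insert (t, m, p) W)"
proof -
  note D = wf_mixedD[OF assms(1)]
  have disj: "w \<in> W \<Longrightarrow> wedge_points w \<inter> {t, p, m} = {}" for w
    using wf_mixed_insert_disjoint[OF assms] unfolding wedge_support_def by blast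
  have supp: "wedge_support (insert (t, m, p) W) = wedge_support (insert (t, p, m) W)"
    by (simp add: insert_commute)
  show ?thesis
  proof (rule wf_mixedI, unfold supp)
    fix w w' assume "w \<in> insert (t, m, p) W" "w' \<in> insert (t, m, p) W" "w \<noteq> w'"
    then show "wedge_points w \<inter> wedge_points w' = {}"
      using disj[of w] disj[of w'] D(5)[of w w'] by (auto simp: Int_commute insert_commute)
  next
    fix t' p' m' assume "(t', p', m') \<in> insert (t, m, p) W"
    then show "distinct [t', p', m']" "\<exists>i. {p', m'} \<subseteq> set (c i)"
      using D(3,4)[of t' p' m'] D(3,4)[of t p m] by auto
  qed (use D(1,2,6,7,8) in auto)
qed

text \<open>Keeping the leg \<open>p\<close> turns the wedge into a strut, which
  \<open>wf_graph_insert_strut\<close> accepts; the other wedges do not meet \<open>m\<close>, so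
  they survive its removal.\<close>

lemma wf_mixed_insertD:
  assumes wf: "wf_mixed c C V (insert (t, p, m) W)" and "(t, p, m) \<notin> W"
  shows "wf_mixed (drop_points {m} c) (insert {t, p} C) V W"
proof -
  have disj: "{t, p, m} \<inter> wedge_support W = {}"
    using assms by (rule wf_mixed_insert_disjoint)
  have d: "distinct [t, p, m]" "{t, p, m} \<subseteq> points c" "{t, p, m} \<inter> half_edges V = {}"
    using wf by (auto simp: wf_mixed_def)
  define P where "P = points c - ({t, p, m} \<union> wedge_support W)"
  have g: "wf_graph P C V"
    using wf by (simp add: wf_mixed_def P_def)
  have "wf_graph (insert t (insert p P)) (insert {t, p} C) V"
    using d wf_graph_Union[OF g] by (subst wf_graph_insert_strut) (use g in \<open>auto simp: P_def\<close>)
  moreover have "insert t (insert p P) = points (drop_points {m} c) - wedge_support W"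
    using d disj by (auto simp: P_def)
  ultimately have g': "wf_graph (points (drop_points {m} c) - wedge_support W) (insert {t, p} C) V"
    by simp
  note D = wf_mixedD[OF wf]
  show ?thesis
  proof (rule wf_mixedI)
    fix t' p' m' assume w: "(t', p', m') \<in> W"
    show "distinct [t', p', m']"
      using D(3)[of t' p' m'] w by blast
    have "m \<notin> {p', m'}"
      using disj w unfolding wedge_support_def by fastforce
    then show "\<exists>i. {p', m'} \<subseteq> set (drop_points {m} c i)"
      using D(4)[of t' p' m'] w by auto
  next
    show "wedge_support W \<subseteq> points (drop_points {m} c)"
      using D(6) disj by auto
    show "wf_circles (drop_points {m} c)"
      using D(1) by (rule wf_circles_drop_points)
  qed (use g' D(2,7) D(5) in simp_all)
qed

lemma wf_mixed_insertD':
  assumes wf: "wf_mixed c C V (insert (t, p, m) W)" and "(t, p, m) \<notin> W"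
  shows "wf_mixed (drop_points {p} c) (insert {t, m} C) V W"
proof -
  have "(t, m, p) \<notin> W"
    using wf_mixed_insert_disjoint[OF assms] unfolding wedge_support_def by fastforce
  then show ?thesis
    using wf_mixed_insertD wf_mixed_swap_legs[OF assms] by blast
qed

text \<open>Opens a strut into a wedge: the second leg ends at a new point \<open>m\<close> on the
  circle of \<open>p\<close> that belongs to no other part of the diagram.\<close>

lemma wf_mixed_insertI:
  assumes wf: "wf_mixed (drop_points {m} c) (insert {t, p} C) V W"
    and "{t, p} \<inter> \<Union>C = {}" "t \<noteq> p" "t \<in> points c" "{p, m} \<subseteq> set (c i)" "wf_circles c"
      "m \<notin> half_edges V" "m \<notin> {t, p}" "m \<notin> wedge_support W"
  shows "wf_mixed c C V (insert (t, p, m) W)"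
proof -
  define P where "P = points c - {t, p, m} - wedge_support W"
  have g: "wf_graph (points (drop_points {m} c) - wedge_support W) (insert {t, p} C) V"
    using wf by (simp add: wf_mixed_def)
  have pts: "{t, p, m} \<subseteq> points c"
    using assms unfolding points_def by blast
  then have tp: "{t, p} \<inter> half_edges V = {}"
    using wf assms(8) unfolding wf_mixed_def wf_graph_def by auto
  moreover have "{t, p} \<subseteq> \<Union>(insert {t, p} C)" by blast
  ultimately have disj: "{t, p, m} \<inter> wedge_support W = {}"
    using wf_graph_Union[OF g] assms(9) by auto
  then have "points (drop_points {m} c) - wedge_support W = insert t (insert p P)"
    using pts assms(8) by (auto simp: P_def)
  then have "wf_graph P C V"
    using g tp assms(2,3) wf_graph_insert_strut[of t p P V C] by (auto simp: P_def)
  moreover have "P = points c - wedge_support (insert (t, p, m) W)"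
    by (auto simp: P_def)
  moreover have disj': "w \<in> W \<Longrightarrow> wedge_points w \<inter> {t, p, m} = {}" for w
    using disj unfolding wedge_support_def by blast
  ultimately have g': "wf_graph (points c - wedge_support (insert (t, p, m) W)) C V"
    by simp
  note D = wf_mixedD[OF wf]
  show ?thesis
  proof (rule wf_mixedI)
    fix w w' assume "w \<in> insert (t, p, m) W" "w' \<in> insert (t, p, m) W" "w \<noteq> w'"
    then show "wedge_points w \<inter> wedge_points w' = {}"
      using disj'[of w] disj'[of w'] D(5)[of w w'] by (auto simp: Int_commute insert_commute)
  next
    fix t' p' m' assume w: "(t', p', m') \<in> insert (t, p, m) W"
    then show "distinct [t', p', m']"
      using D(3)[of t' p' m'] assms(3,8) by (elim insertE) simp_all
    show "\<exists>i. {p', m'} \<subseteq> set (c i)"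
      using w D(4)[of t' p' m'] assms(5) by (elim insertE) auto
  next
    show "wedge_support (insert (t, p, m) W) \<subseteq> points c"
      "wedge_support (insert (t, p, m) W) \<inter> half_edges V = {}"
      using D(6,7) pts tp assms(7) by auto
  qed (use g' D(2) assms(6) in auto)
qed

lemma wf_tri_mixed_resolution:
  assumes "wf_mixed c C V W"
  shows "wf_tri (mixed_resolution c C V W S)"
proof -
  have "finite W" using assms by (simp add: wf_mixed_def)
  then show ?thesis
    using assms
  \<comment> \<open>Resolving one wedge changes both the circles and the chords, so both are
    generalised.\<close>
  proof (induction W arbitrary: c C)
    case empty
    then show ?case
      by (simp add: mixed_resolution_def wf_tri_iff wf_mixed_def)
  next
    case (insert w W)
    obtain t p m where w: "w = (t, p, m)" by (metis prod_cases3)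
    show ?case
      using insert.IH insert.hyps(2) wf_mixed_insertD[of c C V t p m W]
        wf_mixed_insertD'[of c C V t p m W] insert.prems
      by (simp add: w mixed_resolution_insert)
  qed
qed

lemma diagram_class_eqI: "tri_iso D D' \<Longrightarrow> diagram_class D = diagram_class D'"
  by (metis Quotient3_rel_abs[OF Quotient3_trivalent_diagram] diagram_class_def)

text \<open>A relabelling is an isomorphism of each single resolution. Since \<open>f\<close> fixes
  all labels of wedges and vertices, \<open>W\<close> and \<open>V\<close> stay literally the same
  and both sums run over the same choices \<open>S\<close>.\<close>

lemma mixed_sum_rename:
  assumes wf: "wf_mixed c C V W" and wf': "wf_mixed (\<lambda>i. map f (c i)) ((\<lambda>A. f ` A) ` C) V W"
    and f: "bij f" "\<And>x. x \<in> half_edges V \<union> wedge_support W \<Longrightarrow> f x = x"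
  shows "mixed_sum (\<lambda>i. map f (c i)) ((\<lambda>A. f ` A) ` C) V W = mixed_sum c C V W"
proof -
  let ?c = "\<lambda>i. map f (c i)" and ?C = "(\<lambda>A. f ` A) ` C"
  have "tri_iso (mixed_resolution c C V W S) (mixed_resolution ?c ?C V W S)" for S
  proof -
    have fixW: "f t = t" "f p = p" "f m = m" if "(t, p, m) \<in> W" for t p m
      using f(2) that unfolding wedge_support_def by fastforce+
    have lost: "f x = x" if "x \<in> lost_leg S ` W" for x
      using that fixW by (auto simp: lost_leg_def)
    \<comment> \<open>As \<open>f\<close> is injective and fixes every lost leg, no other label is
      mapped to a lost leg; hence dropping points commutes with renaming.\<close>
    have filt: "x \<in> lost_leg S ` W \<longleftrightarrow> f x \<in> lost_leg S ` W" for x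
      using lost f(1) by (metis bij_def injD)
    have "map_prod f f ` v = v" if "v \<in> V" for v
    proof -
      have "map_prod f f z = z" if "z \<in> v" for z
      proof -
        have "fst z \<in> half_edges V" "snd z \<in> half_edges V"
          using that \<open>v \<in> V\<close> FieldI1[of "fst z" "snd z" v] FieldI2[of "fst z" "snd z" v]
          unfolding half_edges_def by auto
        then show ?thesis
          using f(2) by (simp add: prod_eq_iff)
      qed
      then show ?thesis by simp
    qed
    then have V: "V = (\<lambda>v. map_prod f f ` v) ` V" by simp
    have "f ` leg_chord S w = leg_chord S w" if "w \<in> W" for w
      using that fixW by (cases w) (auto simp: leg_chord_def)
    then have legs: "leg_chord S ` W = (\<lambda>A. f ` A) ` leg_chord S ` W"
      by (simp add: image_image)
    have "drop_points (lost_leg S ` W) ?c i = map f (drop_points (lost_leg S ` W) c i)" for i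
      using filt by (simp add: drop_points_def filter_map comp_def)
    then have "circles_iso f (drop_points (lost_leg S ` W) c) (drop_points (lost_leg S ` W) ?c)"
      unfolding circles_iso_def by (intro allI exI[of _ 0]) simp
    then show ?thesis
      unfolding tri_iso_def
      using wf_tri_mixed_resolution[OF wf] wf_tri_mixed_resolution[OF wf'] f(1) V legs
      by (intro conjI exI[of _ f]) (simp_all add: mixed_resolution_def image_Un)
  qed
  then have "diagram_class (mixed_resolution c C V W S) =
      diagram_class (mixed_resolution ?c ?C V W S)" for S
    by (rule diagram_class_eqI)
  then show ?thesis
    by (simp add: mixed_sum_def)
qed

section \<open>The STU relation for mixed diagrams\<close>

lemma points_upd: "points (c(i := xs @ ys @ zs)) = set ys \<union> points (c(i := xs @ zs))"
  unfolding points_def by (auto split: if_splits)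

lemma set_subset_points_upd: "set xs \<union> set zs \<subseteq> points (c(i := xs @ zs))"
  unfolding points_def by (auto split: if_splits)

lemma points_subset_points_upd: "j \<noteq> i \<Longrightarrow> set (c j) \<subseteq> points (c(i := xs @ zs))"
  unfolding points_def by (auto split: if_splits)

text \<open>Every local move replaces a block \<open>ys\<close> between fixed \<open>xs\<close> and
  \<open>zs\<close>. This separates the conditions on the block from those on the unchanged
  remainder.\<close>

lemma wf_circles_upd:
  "wf_circles (c(i := xs @ ys @ zs)) \<longleftrightarrow>
    wf_circles (c(i := xs @ zs)) \<and> distinct ys \<and> set ys \<inter> points (c(i := xs @ zs)) = {}"
proof -
  have "points (c(i := xs @ zs)) = set xs \<union> set zs \<union> (\<Union>j\<in>{j. j \<noteq> i}. set (c j))"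
    unfolding points_def by (auto split: if_splits)
  then have disj: "set ys \<inter> points (c(i := xs @ zs)) = {} \<longleftrightarrow>
      set ys \<inter> set xs = {} \<and> set ys \<inter> set zs = {} \<and> (\<forall>j. j \<noteq> i \<longrightarrow> set ys \<inter> set (c j) = {})"
    by blast
  have circles: "wf_circles (c(i := us)) \<longleftrightarrow>
      distinct us \<and> (\<forall>j. j \<noteq> i \<longrightarrow> set us \<inter> set (c j) = {}) \<and> wf_circles (c(i := []))" for us
  proof
    assume *: "wf_circles (c(i := us))"
    have "set us \<inter> set (c j) = {}" if "j \<noteq> i" for j
      using * that unfolding wf_circles_def fun_upd_apply by metis+
    moreover have "distinct us"
      using * unfolding wf_circles_def fun_upd_apply by metis
    moreover have "distinct (c j)" if "j \<noteq> i" for j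
      using * that unfolding wf_circles_def fun_upd_apply by metis
    moreover have "set (c j) \<inter> set (c k) = {}" if "j \<noteq> i" "k \<noteq> i" "j \<noteq> k" for j k
      using * that unfolding wf_circles_def fun_upd_apply by metis
    ultimately show "distinct us \<and> (\<forall>j. j \<noteq> i \<longrightarrow> set us \<inter> set (c j) = {}) \<and> wf_circles (c(i := []))"
      unfolding wf_circles_def by simp
  next
    assume *: "distinct us \<and> (\<forall>j. j \<noteq> i \<longrightarrow> set us \<inter> set (c j) = {}) \<and> wf_circles (c(i := []))"
    then have "distinct (c j)" "set (c j) \<inter> set (c k) = {}" if "j \<noteq> i" "k \<noteq> i" "j \<noteq> k" for j k
      using that unfolding wf_circles_def fun_upd_apply by metis+
    moreover have "distinct (c j)" if "j \<noteq> i" for j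
      using * that unfolding wf_circles_def fun_upd_apply by metis
    ultimately show "wf_circles (c(i := us))"
      using * unfolding wf_circles_def by (auto simp: Int_commute)
  qed
  show ?thesis
    unfolding disj circles[of "xs @ ys @ zs"] circles[of "xs @ zs"] distinct_append set_append by blast
qed

lemma replace_point_upd:
  assumes "e \<notin> points (c(i := xs @ zs))"
  shows "replace_point e ys (c(i := xs @ [e] @ zs)) = c(i := xs @ ys @ zs)"
proof -
  have *: "concat (map (\<lambda>z. if z = e then ys else [z]) us) = us" if "e \<notin> set us" for us
    using that by (induction us) auto
  have "e \<notin> set xs" "e \<notin> set zs" "\<And>j. j \<noteq> i \<Longrightarrow> e \<notin> set (c j)"
    using assms set_subset_points_upd[of xs zs c i] points_subset_points_upd[of _ i c xs zs] by auto
  then show ?thesis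
    by (auto simp: replace_point_def fun_eq_iff *)
qed

text \<open>The defining STU relation in block notation. As the chord and the vertex are new to
  \<open>C\<close> and \<open>V\<close>, the set differences in \<open>tri_STU\<close> give back
  \<open>C\<close> and \<open>V\<close>.\<close>

lemma diagram_class_STU:
  assumes wf: "wf_tri (Tri_Pres (c(i := xs @ [e] @ zs)) (insert {e, h} C) (insert (cyc3 h p q) V))"
    "wf_tri (Tri_Pres (c(i := xs @ [q, p] @ zs)) C V)" "wf_tri (Tri_Pres (c(i := xs @ [p, q] @ zs)) C V)"
    and "{e, h} \<notin> C" "cyc3 h p q \<notin> V"
  shows "diagram_class (Tri_Pres (c(i := xs @ [e] @ zs)) (insert {e, h} C) (insert (cyc3 h p q) V)) =
    diagram_class (Tri_Pres (c(i := xs @ [q, p] @ zs)) C V) -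
    diagram_class (Tri_Pres (c(i := xs @ [p, q] @ zs)) C V)"
proof -
  let ?c = "c(i := xs @ [e] @ zs)" and ?C = "insert {e, h} C" and ?V = "insert (cyc3 h p q) V"
  define D where "D = (\<lambda>ys. Tri_Pres (replace_point e ys ?c) (?C - {{e, h}}) (?V - {cyc3 h p q}))"
  have e: "e \<notin> points (c(i := xs @ zs))"
    using wf(1) unfolding wf_tri_iff wf_circles_upd by simp
  have D: "D ys = Tri_Pres (c(i := xs @ ys @ zs)) C V" for ys
    using assms(4,5) by (simp only: D_def replace_point_upd[OF e]) simp
  have "gen (abs_trivalent_diagram (Tri_Pres ?c ?C ?V)) -
      (gen (abs_trivalent_diagram (D [q, p])) - gen (abs_trivalent_diagram (D [p, q]))) \<in> tri_STU"
    unfolding tri_STU_def mem_Collect_eq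
  proof (intro exI conjI)
    show "D = (\<lambda>ys. Tri_Pres (replace_point e ys ?c) (?C - {{e, h}}) (?V - {cyc3 h p q}))"
      by (rule D_def)
    show "e \<in> points ?c" unfolding points_upd by simp
    show "wf_tri (D [q, p])" "wf_tri (D [p, q])" using wf by (simp_all only: D)
  qed (use wf in simp_all)
  then show ?thesis
    unfolding diagram_class_def D minus_At.abs_eq At.abs_eq_iff
    by (intro free.span_base) blast
qed

text \<open>Apart from \<open>wf_circles\<close>, the conditions only record which points lie on
  which circle, not their order.\<close>

lemma wf_mixed_cong:
  assumes "wf_mixed c C V W" "wf_circles c'" "\<And>i. set (c i) = set (c' i)"
  shows "wf_mixed c' C V W"
proof -
  have "points c = points c'" unfolding points_def using assms(3) by simp
  then show ?thesis using assms unfolding wf_mixed_def by simp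
qed

lemma wf_mixed_swap:
  assumes "wf_mixed (c(i := xs @ [p, q] @ zs)) C V W"
  shows "wf_mixed (c(i := xs @ [q, p] @ zs)) C V W"
proof (rule wf_mixed_cong[OF assms])
  show "wf_circles (c(i := xs @ [q, p] @ zs))"
    using wf_mixed_circles[OF assms] unfolding wf_circles_upd by auto
qed auto

text \<open>The two diagrams differ only in the labels \<open>e, h, p, q\<close>. No wedge meets
  these, so the conditions on wedges agree, and the graph is covered by
  \<open>wf_graph_STU\<close>.\<close>

lemma wf_mixed_STU:
  assumes "distinct [e, h, p, q]"
    and "{e, h, p, q} \<inter> (points (c(i := xs @ zs)) \<union> half_edges V \<union> wedge_support W) = {}"
    and "{e, h} \<inter> \<Union>C = {}"
  shows "wf_mixed (c(i := xs @ [e] @ zs)) (insert {e, h} C) (insert (cyc3 h p q) V) W \<longleftrightarrow>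
    wf_mixed (c(i := xs @ [p, q] @ zs)) C V W"
proof -
  define P where "P = points (c(i := xs @ zs)) - wedge_support W"
  let ?c = "c(i := xs @ [e] @ zs)" and ?c' = "c(i := xs @ [p, q] @ zs)"
  have P: "points ?c - wedge_support W = insert e P" "points ?c' - wedge_support W = insert p (insert q P)"
    unfolding P_def points_upd using assms(2) by auto
  have graph: "wf_graph (insert e P) (insert {e, h} C) (insert (cyc3 h p q) V) \<longleftrightarrow>
      wf_graph (insert p (insert q P)) C V"
    using assms by (intro wf_graph_STU) (auto simp: P_def)
  have circles: "wf_circles ?c \<longleftrightarrow> wf_circles ?c'"
    unfolding wf_circles_upd using assms(1,2) by auto
  have supp: "wedge_support W \<subseteq> points ?c \<longleftrightarrow> wedge_support W \<subseteq> points ?c'"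
    unfolding points_upd using assms(2) by auto
  have half: "wedge_support W \<inter> half_edges (insert (cyc3 h p q) V) = {} \<longleftrightarrow>
      wedge_support W \<inter> half_edges V = {}"
    using assms(2) by auto
  have leg: "(\<exists>j. {p', m'} \<subseteq> set (?c j)) \<longleftrightarrow> (\<exists>j. {p', m'} \<subseteq> set (?c' j))"
    if "(t', p', m') \<in> W" for t' p' m'
  proof -
    have "{p', m'} \<subseteq> wedge_support W"
      using that unfolding wedge_support_def by fastforce
    then have "{p', m'} \<inter> {e, h, p, q} = {}"
      using assms(2) by blast
    then have "{p', m'} \<subseteq> set (?c j) \<longleftrightarrow> {p', m'} \<subseteq> set (?c' j)" for j
      by auto
    then show ?thesis by simp
  qed
  have legs: "(\<forall>(t', p', m')\<in>W. distinct [t', p', m'] \<and> (\<exists>j. {p', m'} \<subseteq> set (?c j))) \<longleftrightarrow>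
      (\<forall>(t', p', m')\<in>W. distinct [t', p', m'] \<and> (\<exists>j. {p', m'} \<subseteq> set (?c' j)))"
  proof (intro ball_cong refl)
    fix w assume "w \<in> W"
    moreover obtain t' p' m' where "w = (t', p', m')" by (metis prod_cases3)
    ultimately show "(case w of (t', p', m') \<Rightarrow> distinct [t', p', m'] \<and> (\<exists>j. {p', m'} \<subseteq> set (?c j))) \<longleftrightarrow>
        (case w of (t', p', m') \<Rightarrow> distinct [t', p', m'] \<and> (\<exists>j. {p', m'} \<subseteq> set (?c' j)))"
      using leg[of t' p' m'] by (simp only: prod.case)
  qed
  show ?thesis
    unfolding wf_mixed_def P circles legs supp half graph by (rule refl)
qed

lemma lost_leg_subset: "lost_leg S ` W \<subseteq> wedge_support W"
proof -
  have "lost_leg S w \<in> wedge_points w" for w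
    by (cases w) (simp add: lost_leg_def)
  then show ?thesis unfolding wedge_support_def by blast
qed

lemma leg_chord_subset: "\<Union>(leg_chord S ` W) \<subseteq> wedge_support W"
proof -
  have "leg_chord S w \<subseteq> wedge_points w" for w
    by (cases w) (simp add: leg_chord_def)
  then show ?thesis unfolding wedge_support_def by blast
qed

text \<open>STU is applied to each choice of legs separately. The labels \<open>e, h, p, q\<close>
  lie on no wedge, so they are never dropped and the block keeps its shape in every
  resolution.\<close>

lemma mixed_sum_STU:
  assumes "distinct [e, h, p, q]"
    and "{e, h, p, q} \<inter> (points (c(i := xs @ zs)) \<union> half_edges V \<union> wedge_support W) = {}"
    and "{e, h} \<inter> \<Union>C = {}"
    and wf: "wf_mixed (c(i := xs @ [p, q] @ zs)) C V W"
  shows "mixed_sum (c(i := xs @ [e] @ zs)) (insert {e, h} C) (insert (cyc3 h p q) V) W =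
    mixed_sum (c(i := xs @ [q, p] @ zs)) C V W - mixed_sum (c(i := xs @ [p, q] @ zs)) C V W"
proof -
  have wf': "wf_mixed (c(i := xs @ [e] @ zs)) (insert {e, h} C) (insert (cyc3 h p q) V) W"
    using wf_mixed_STU[OF assms(1-3)] wf by simp
  have "diagram_class (mixed_resolution (c(i := xs @ [e] @ zs)) (insert {e, h} C) (insert (cyc3 h p q) V) W S) =
      diagram_class (mixed_resolution (c(i := xs @ [q, p] @ zs)) C V W S) -
      diagram_class (mixed_resolution (c(i := xs @ [p, q] @ zs)) C V W S)" for S
  proof -
    let ?A = "lost_leg S ` W"
    define d where "d = drop_points ?A c"
    define xs' zs' where "xs' = filter (\<lambda>x. x \<notin> ?A) xs" and "zs' = filter (\<lambda>x. x \<notin> ?A) zs"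
    have "x \<notin> ?A" if "x \<in> {e, h, p, q}" for x
      using that assms(2) lost_leg_subset[of S W] by blast
    then have "filter (\<lambda>x. x \<notin> ?A) [e] = [e]" "filter (\<lambda>x. x \<notin> ?A) [p, q] = [p, q]"
      "filter (\<lambda>x. x \<notin> ?A) [q, p] = [q, p]" by auto
    then have drop: "drop_points ?A (c(i := xs @ [e] @ zs)) = d(i := xs' @ [e] @ zs')"
      "drop_points ?A (c(i := xs @ [p, q] @ zs)) = d(i := xs' @ [p, q] @ zs')"
      "drop_points ?A (c(i := xs @ [q, p] @ zs)) = d(i := xs' @ [q, p] @ zs')"
      by (simp_all only: drop_points_upd filter_append d_def xs'_def zs'_def)
    note wfs = wf_tri_mixed_resolution[OF wf, of S] wf_tri_mixed_resolution[OF wf', of S]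
      wf_tri_mixed_resolution[OF wf_mixed_swap[OF wf], of S]
    have "{e, h} \<inter> \<Union>(leg_chord S ` W \<union> C) = {}"
      using assms(2,3) leg_chord_subset[of S W] by blast
    then have "{e, h} \<notin> leg_chord S ` W \<union> C" by blast
    moreover have "cyc3 h p q \<notin> V"
    proof
      assume "cyc3 h p q \<in> V"
      then have "h \<in> half_edges V" unfolding half_edges_def by force
      then show False using assms(2) by simp
    qed
    ultimately show ?thesis
      using wfs unfolding mixed_resolution_def drop Un_insert_right
      by (intro diagram_class_STU)
  qed
  then show ?thesis
    by (simp add: mixed_sum_def At.scale_right_diff_distrib sum_subtractf)
qed

section \<open>Exchange of two labels, and cancellation of adjacent legs\<close>

lemma image_transpose_fresh:
  "{x, y} \<inter> \<Union>C = {} \<Longrightarrow> (\<lambda>A. transpose x y ` A) ` C = C"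
proof -
  assume *: "{x, y} \<inter> \<Union>C = {}"
  have "transpose x y ` A = A" if "A \<in> C" for A
  proof -
    have "z \<in> A \<Longrightarrow> transpose x y z = z" for z
      using * that by (intro transpose_apply_other) auto
    then show ?thesis by simp
  qed
  then show ?thesis by simp
qed

text \<open>Since \<open>x\<close> and \<open>y\<close> can occur only in the block and in
  \<open>C\<close>, the transposition acts nowhere else, and \<open>mixed_sum_rename\<close>
  applies.\<close>

lemma mixed_sum_transpose:
  assumes wf: "wf_mixed (c(i := xs @ ys @ zs)) C V W"
    and wf': "wf_mixed (c(i := xs @ map (transpose x y) ys @ zs)) ((\<lambda>A. transpose x y ` A) ` C) V W"
    and "{x, y} \<inter> (points (c(i := xs @ zs)) \<union> half_edges V \<union> wedge_support W) = {}"
  shows "mixed_sum (c(i := xs @ map (transpose x y) ys @ zs)) ((\<lambda>A. transpose x y ` A) ` C) V W =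
    mixed_sum (c(i := xs @ ys @ zs)) C V W"
proof -
  have "map (transpose x y) us = us" if "set us \<subseteq> points (c(i := xs @ zs))" for us
    using assms(3) that by (intro map_idI transpose_apply_other) auto
  then have "map (transpose x y) xs = xs" "map (transpose x y) zs = zs"
    "\<And>j. j \<noteq> i \<Longrightarrow> map (transpose x y) (c j) = c j"
    using set_subset_points_upd[of xs zs c i] points_subset_points_upd[of _ i c xs zs] by auto
  then have *: "(\<lambda>j. map (transpose x y) ((c(i := xs @ ys @ zs)) j)) =
      c(i := xs @ map (transpose x y) ys @ zs)"
    by (auto simp: fun_eq_iff)
  have "transpose x y z = z" if "z \<in> half_edges V \<union> wedge_support W" for z
    using assms(3) that by (intro transpose_apply_other) auto
  then show ?thesis
    using mixed_sum_rename[OF wf, of "transpose x y"] wf' unfolding * by simp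
qed

text \<open>With nothing between the legs, keeping \<open>p\<close> and keeping \<open>m\<close>
  give the same diagram up to exchanging these two labels, and the two terms have opposite
  signs.\<close>

lemma mixed_sum_adjacent_legs:
  assumes wf: "wf_mixed (c(i := xs @ [p, m] @ zs)) C V (insert (t, p, m) W)"
    and "(t, p, m) \<notin> W"
  shows "mixed_sum (c(i := xs @ [p, m] @ zs)) C V (insert (t, p, m) W) = 0"
proof -
  let ?c = "c(i := xs @ [p, m] @ zs)"
  have fresh: "p \<noteq> m" "{p, m} \<inter> points (c(i := xs @ zs)) = {}"
    using wf_mixed_circles[OF wf] unfolding wf_circles_upd by auto
  have "{p, m} \<subseteq> wedge_support (insert (t, p, m) W)" by simp
  then have wedge: "distinct [t, p, m]" "{p, m} \<inter> half_edges V = {}" "{p, m} \<inter> \<Union>C = {}"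
    using wf_mixed_distinct[OF wf, of t p m] wf_mixed_support[OF wf]
    unfolding wf_mixed_Union[OF wf] by blast+
  have disj: "{p, m} \<inter> wedge_support W = {}"
    using wf_mixed_insert_disjoint[OF assms] by auto
  have "filter (\<lambda>x. x \<notin> {a}) us = us" if "set us \<subseteq> points (c(i := xs @ zs))" "a \<in> {p, m}" for us a
    using that fresh(2) by (intro filter_True) auto
  then have filt: "filter (\<lambda>x. x \<notin> {a}) xs = xs" "filter (\<lambda>x. x \<notin> {a}) zs = zs"
    "\<And>j. j \<noteq> i \<Longrightarrow> filter (\<lambda>x. x \<notin> {a}) (c j) = c j" if "a \<in> {p, m}" for a
    using that set_subset_points_upd[of xs zs c i] points_subset_points_upd[of _ i c xs zs] by auto
  have drop: "drop_points {m} ?c = c(i := xs @ [p] @ zs)" "drop_points {p} ?c = c(i := xs @ [m] @ zs)"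
    using fresh(1) filt[of m] filt[of p] by (auto simp: drop_points_def)
  have chords: "(\<lambda>A. transpose p m ` A) ` insert {t, p} C = insert {t, m} C"
    using image_transpose_fresh[OF wedge(3)] wedge(1) by simp
  have map: "map (transpose p m) [p] = [m]" by simp
  note wfs = wf_mixed_insertD[OF assms] wf_mixed_insertD'[OF assms]
  have "mixed_sum (c(i := xs @ [m] @ zs)) (insert {t, m} C) V W =
      mixed_sum (c(i := xs @ [p] @ zs)) (insert {t, p} C) V W"
    using mixed_sum_transpose[of c i xs "[p]" zs "insert {t, p} C" V W p m] wfs fresh(2) wedge(2) disj
    unfolding drop chords map by blast
  then show ?thesis
    using mixed_sum_insert[of W t p m ?c C V] assms(2) wf_mixed_finite[OF wf]
    unfolding drop by simp
qed

section \<open>The image of \<open>\<iota>\<close> is strutless\<close>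

lemma ex_two_fresh:
  assumes "finite (A :: nat set)"
  obtains e h where "e \<noteq> h" "{e, h} \<inter> A = {}"
proof -
  obtain e where "e \<notin> A" using assms ex_new_if_finite by blast
  moreover obtain h where "h \<notin> insert e A" using assms ex_new_if_finite[of "insert e A"] by auto
  ultimately show ?thesis using that[of e h] by auto
qed

lemma wf_mixed_points_half_edges:
  assumes "wf_mixed c C V W"
  shows "points c \<inter> half_edges V = {}"
  using wf_mixed_graph[OF assms] wf_mixed_support(2)[OF assms] unfolding wf_graph_def by blast

lemma finite_labels:
  assumes "wf_mixed (c :: ('l::finite) circles) C V W"
  shows "finite (points c \<union> half_edges V \<union> wedge_support W \<union> \<Union>C)"
proof -
  have "finite (half_edges V)" "finite (points c)" "finite (wedge_support W)"
    using finite_half_edges[OF wf_mixed_graph[OF assms]] finite_points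
      finite_subset[OF wf_mixed_support(1)[OF assms]] by blast+
  then show ?thesis
    unfolding wf_mixed_Union[OF assms] by simp
qed

lemma zero_in_strutless_space: "0 \<in> strutless_space"
  unfolding strutless_space_def by (rule At.span_zero)

lemma neg_in_strutless_space: "x \<in> strutless_space \<Longrightarrow> - x \<in> strutless_space"
  unfolding strutless_space_def by (rule At.span_neg)

lemma add_in_strutless_space: "x \<in> strutless_space \<Longrightarrow> y \<in> strutless_space \<Longrightarrow> x + y \<in> strutless_space"
  unfolding strutless_space_def by (rule At.span_add)

lemma diff_in_strutless_space: "x \<in> strutless_space \<Longrightarrow> y \<in> strutless_space \<Longrightarrow> x - y \<in> strutless_space"
  unfolding strutless_space_def by (rule At.span_diff)

text \<open>Packages the induction hypothesis on the number of wedges, so that the moves of the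
  inductive step become separate lemmas; \<open>l\<close> fixes the type of circle indices.\<close>

locale strutless_below =
  fixes n :: nat and l :: "('l::finite) itself"
  assumes mixed_sum_below:
    "\<And>(c :: 'l circles) C V W. wf_mixed c C V W \<Longrightarrow> card W < n \<Longrightarrow> \<forall>A\<in>C. \<not> A \<subseteq> points c \<Longrightarrow>
      mixed_sum c C V W \<in> strutless_space"
begin

text \<open>STU read backwards: the difference of the two orders is a diagram with a new vertex, to
  which the chords at \<open>p\<close> and \<open>x\<close> are now attached. These were the only
  possible struts.\<close>

lemma swap_external:
  fixes c :: "'l circles"
  assumes wf: "wf_mixed (c(i := xs @ [p, x] @ zs)) C V W" and "card W < n"
    and supp: "{p, x} \<inter> wedge_support W = {}"
    and strut: "\<And>A. A \<in> C \<Longrightarrow> A \<subseteq> points (c(i := xs @ [p, x] @ zs)) \<Longrightarrow> A \<inter> {p, x} \<noteq> {}"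
  shows "mixed_sum (c(i := xs @ [p, x] @ zs)) C V W - mixed_sum (c(i := xs @ [x, p] @ zs)) C V W
    \<in> strutless_space"
proof -
  let ?P = "points (c(i := xs @ zs))"
  have points: "points (c(i := xs @ [p, x] @ zs)) = {p, x} \<union> ?P"
    unfolding points_upd by simp
  obtain e h where eh: "e \<noteq> h"
    "{e, h} \<inter> ({p, x} \<union> ?P \<union> half_edges V \<union> wedge_support W \<union> \<Union>C) = {}"
    by (rule ex_two_fresh[OF finite_labels[OF wf, unfolded points]])
  have px: "p \<noteq> x" "{p, x} \<inter> ?P = {}"
    using wf_mixed_circles[OF wf] unfolding wf_circles_upd by auto
  have half: "{p, x} \<inter> half_edges V = {}"
    using wf_mixed_points_half_edges[OF wf] unfolding points by blast
  have fresh: "distinct [e, h, x, p]" "{e, h, x, p} \<inter> (?P \<union> half_edges V \<union> wedge_support W) = {}"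
    "{e, h} \<inter> \<Union>C = {}"
    using eh px half supp by auto
  \<comment> \<open>The cyclic order \<open>(h, x, p)\<close> is chosen so that STU yields the
    difference with the required sign.\<close>
  let ?c = "c(i := xs @ [e] @ zs)" and ?C = "insert {e, h} C" and ?V = "insert (cyc3 h x p) V"
  note wf' = wf_mixed_swap[OF wf]
  have "wf_mixed ?c ?C ?V W"
    using wf' by (rule wf_mixed_STU[OF fresh, THEN iffD2])
  \<comment> \<open>The chord \<open>{e, h}\<close> has the internal end \<open>h\<close>; any other
    strut would avoid \<open>p\<close> and \<open>x\<close> and so contradict
    \<open>strut\<close>.\<close>
  moreover have "\<not> A \<subseteq> points ?c" if "A \<in> ?C" for A
  proof
    assume A: "A \<subseteq> points ?c"
    have pts: "points ?c = insert e ?P" unfolding points_upd by simp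
    have "h \<notin> points ?c" using eh unfolding pts by auto
    then have "A \<in> C" using that A by blast
    moreover have "A \<subseteq> ?P"
      using A eh(2) \<open>A \<in> C\<close> unfolding pts by blast
    ultimately show False
      using strut[of A] px(2) unfolding points by blast
  qed
  ultimately have "mixed_sum ?c ?C ?V W \<in> strutless_space"
    using \<open>card W < n\<close> by (intro mixed_sum_below ballI)
  then show ?thesis
    unfolding mixed_sum_STU[OF fresh wf'] .
qed

text \<open>If \<open>x\<close> lies on a wedge, that wedge is resolved as well; the new vertex meets both its chords.\<close>
lemma swap:
  fixes c :: "'l circles"
  assumes wf: "wf_mixed (c(i := xs @ [p, x] @ zs)) C V W" and "card W < n"
    and supp: "p \<notin> wedge_support W"
    and strut: "\<And>A. A \<in> C \<Longrightarrow> A \<subseteq> points (c(i := xs @ [p, x] @ zs)) \<Longrightarrow> p \<in> A"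
  shows "mixed_sum (c(i := xs @ [p, x] @ zs)) C V W - mixed_sum (c(i := xs @ [x, p] @ zs)) C V W
    \<in> strutless_space"
proof (cases "x \<in> wedge_support W")
  case False
  then show ?thesis
    using swap_external[OF wf] assms(2-) by blast
next
  case True
  then obtain w where w: "w \<in> W" "x \<in> wedge_points w"
    unfolding wedge_support_def by blast
  obtain t q m where tqm: "w = (t, q, m)" by (metis prod_cases3)
  obtain W0 where W: "W = insert (t, q, m) W0" "(t, q, m) \<notin> W0"
    using w(1) tqm by (metis mk_disjoint_insert)
  let ?c = "c(i := xs @ [p, x] @ zs)" and ?c' = "c(i := xs @ [x, p] @ zs)"
  have wf0: "wf_mixed ?c C V (insert (t, q, m) W0)" using wf W(1) by simp
  have "finite W0" using wf_mixed_finite[OF wf0] by simp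
  then have "card W0 < n" using W \<open>card W < n\<close> by simp
  have disj: "{t, q, m} \<inter> wedge_support W0 = {}"
    using wf_mixed_insert_disjoint[OF wf0 W(2)] .
  have p: "p \<notin> {t, q, m}" "p \<notin> wedge_support W0" using supp unfolding W(1) by auto
  \<comment> \<open>Treats both choices at once: \<open>a\<close> is the dropped leg,
    \<open>b\<close> the kept one. If \<open>x\<close> is dropped, the two orders coincide;
    otherwise the new strut \<open>{t, b}\<close> ends at \<open>x\<close>, which
    \<open>swap_external\<close> allows.\<close>
  have resolved: "mixed_sum (drop_points {a} ?c) (insert {t, b} C) V W0 -
      mixed_sum (drop_points {a} ?c') (insert {t, b} C) V W0 \<in> strutless_space"
    if ab: "a \<in> {q, m}" "x = a \<or> x \<in> {t, b}"
      and wfa: "wf_mixed (drop_points {a} ?c) (insert {t, b} C) V W0" for a b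
  proof (cases "x = a")
    case True
    then have "drop_points {a} ?c = drop_points {a} ?c'"
      by (simp add: drop_points_upd)
    then show ?thesis by (simp add: zero_in_strutless_space)
  next
    case False
    define d where "d = drop_points {a} c"
    define xs' zs' where "xs' = filter (\<lambda>x. x \<notin> {a}) xs" and "zs' = filter (\<lambda>x. x \<notin> {a}) zs"
    have "p \<noteq> a" using p ab by auto
    then have drop: "drop_points {a} ?c = d(i := xs' @ [p, x] @ zs')"
        "drop_points {a} ?c' = d(i := xs' @ [x, p] @ zs')"
      using False by (simp_all add: drop_points_upd d_def xs'_def zs'_def)
    have "points (drop_points {a} ?c) \<subseteq> points ?c" by auto
    then have "A \<inter> {p, x} \<noteq> {}" if "A \<in> insert {t, b} C" "A \<subseteq> points (drop_points {a} ?c)" for A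
      using that ab(2) False strut[of A] by blast
    moreover have "{p, x} \<inter> wedge_support W0 = {}"
      using p w(2) disj unfolding tqm by auto
    ultimately show ?thesis
      using wfa \<open>card W0 < n\<close> unfolding drop by (intro swap_external)
  qed
  have "mixed_sum (drop_points {m} ?c) (insert {t, q} C) V W0 -
      mixed_sum (drop_points {m} ?c') (insert {t, q} C) V W0 \<in> strutless_space"
    using w(2) wf_mixed_insertD[OF wf0 W(2)] unfolding tqm by (intro resolved) auto
  moreover have "mixed_sum (drop_points {q} ?c) (insert {t, m} C) V W0 -
      mixed_sum (drop_points {q} ?c') (insert {t, m} C) V W0 \<in> strutless_space"
    using w(2) wf_mixed_insertD'[OF wf0 W(2)] unfolding tqm by (intro resolved) auto
  ultimately have "(mixed_sum (drop_points {m} ?c) (insert {t, q} C) V W0 -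
      mixed_sum (drop_points {m} ?c') (insert {t, q} C) V W0) -
      (mixed_sum (drop_points {q} ?c) (insert {t, m} C) V W0 -
      mixed_sum (drop_points {q} ?c') (insert {t, m} C) V W0) \<in> strutless_space"
    by (rule diff_in_strutless_space)
  then show ?thesis
    unfolding W(1) mixed_sum_insert[OF \<open>finite W0\<close> W(2)] by (simp add: algebra_simps)
qed

text \<open>Induction on the points between the legs: \<open>p\<close> moves past the first of them,
  which joins \<open>xs\<close>, until the legs are adjacent and the sum vanishes.\<close>

lemma slide_leg:
  fixes c :: "'l circles"
  assumes "wf_mixed (c(i := xs @ [p] @ ys @ [m] @ zs)) C V (insert (t, p, m) W)"
    and W: "(t, p, m) \<notin> W" "card W < n"
    and "\<forall>A\<in>C. \<not> A \<subseteq> points (c(i := xs @ [p] @ ys @ [m] @ zs))"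
  shows "mixed_sum (c(i := xs @ [p] @ ys @ [m] @ zs)) C V (insert (t, p, m) W) \<in> strutless_space"
  using assms(1,4)
proof (induction ys arbitrary: xs)
  case Nil
  have c: "c(i := xs @ [p] @ [] @ [m] @ zs) = c(i := xs @ [p, m] @ zs)" by simp
  show ?case
    unfolding c mixed_sum_adjacent_legs[OF Nil.prems(1)[unfolded c] W(1)]
    by (rule zero_in_strutless_space)
next
  case (Cons x ys)
  define us where "us = ys @ [m] @ zs"
  let ?c = "c(i := xs @ [p, x] @ us)" and ?c' = "c(i := xs @ [x, p] @ us)"
  have wf: "wf_mixed ?c C V (insert (t, p, m) W)" and strut: "\<forall>A\<in>C. \<not> A \<subseteq> points ?c"
    using Cons.prems by (simp_all only: append.simps us_def)
  note wf' = wf_mixed_swap[OF wf]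
  have "points ?c = points ?c'" unfolding points_upd by auto
  then have "\<forall>A\<in>C. \<not> A \<subseteq> points ?c'" using strut by simp
  with wf' have IH: "mixed_sum ?c' C V (insert (t, p, m) W) \<in> strutless_space"
    using Cons.IH[of "xs @ [x]"] by (simp only: append.simps append_assoc us_def)
  have fin: "finite W" using wf_mixed_finite[OF wf] by simp
  have "distinct [t, p, m]" using wf_mixed_distinct[OF wf] by blast
  moreover have "distinct ([p, x] @ us)"
    using wf_mixed_circles[OF wf] unfolding wf_circles_def by (metis distinct_append fun_upd_same)
  ultimately have neq: "p \<noteq> m" "x \<noteq> m" by (auto simp: us_def)
  define d where "d = drop_points {m} c"
  define xs' us' where "xs' = filter (\<lambda>x. x \<notin> {m}) xs" and "us' = filter (\<lambda>x. x \<notin> {m}) us"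
  have drop: "drop_points {m} ?c = d(i := xs' @ [p, x] @ us')"
    "drop_points {m} ?c' = d(i := xs' @ [x, p] @ us')"
    using neq by (simp_all add: drop_points_upd d_def xs'_def us'_def)
  \<comment> \<open>The term that keeps \<open>m\<close> does not see where \<open>p\<close> was, so
    only the term keeping \<open>p\<close> changes.\<close>
  have drop_p: "drop_points {p} ?c = drop_points {p} ?c'"
    by (simp add: drop_points_upd)
  have "p \<in> A" if "A \<in> insert {t, p} C" "A \<subseteq> points (drop_points {m} ?c)" for A
    using that strut by auto
  moreover have "p \<notin> wedge_support W"
    using wf_mixed_insert_disjoint[OF wf W(1)] by auto
  ultimately have "mixed_sum (drop_points {m} ?c) (insert {t, p} C) V W -
      mixed_sum (drop_points {m} ?c') (insert {t, p} C) V W \<in> strutless_space"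
    using wf_mixed_insertD[OF wf W(1)] W(2) unfolding drop by (intro swap)
  then have "mixed_sum ?c C V (insert (t, p, m) W) - mixed_sum ?c' C V (insert (t, p, m) W)
      \<in> strutless_space"
    unfolding mixed_sum_insert[OF fin W(1)] drop_p by simp
  then have "mixed_sum ?c C V (insert (t, p, m) W) \<in> strutless_space"
    using add_in_strutless_space[OF _ IH] by fastforce
  then show ?case
    by (simp only: append.simps us_def)
qed

end

text \<open>Both legs of a wedge occur in the list of one circle, so the leg listed first can be
  slid forward to the other without rotating the list.\<close>

lemma mixed_sum_in_strutless_space:
  fixes c :: "('l::finite) circles"
  assumes "wf_mixed c C V W" "\<forall>A\<in>C. \<not> A \<subseteq> points c"
  shows "mixed_sum c C V W \<in> strutless_space"
  using assms
proof (induction "card W" arbitrary: c C V W rule: less_induct)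
  case less
  interpret strutless_below "card W" "TYPE('l)"
    by unfold_locales (use less.hyps in blast)
  show ?case
  proof (cases "W = {}")
    case True
    then have "wf_tri (Tri_Pres c C V)" "strutless (Tri_Pres c C V)"
      using less.prems by (simp_all add: wf_mixed_def wf_tri_iff strutless_def external_def)
    then show ?thesis
      unfolding strutless_space_def True mixed_sum_empty diagram_class_def
      by (intro At.span_base) blast
  next
    case False
    then obtain t p m W0 where W: "W = insert (t, p, m) W0" "(t, p, m) \<notin> W0"
      by (metis ex_in_conv mk_disjoint_insert prod_cases3)
    have wf: "wf_mixed c C V (insert (t, p, m) W0)" using less.prems(1) W(1) by simp
    have fin: "finite W0" using wf_mixed_finite[OF wf] by simp
    then have card: "card W0 < card W" using W by simp
    have "(t, m, p) \<notin> W0"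
      using wf_mixed_insert_disjoint[OF wf W(2)] unfolding wedge_support_def by fastforce
    note swapped = mixed_sum_swap_legs[OF fin W(2) this, of c C V] wf_mixed_swap_legs[OF wf W(2)] this
    obtain i where i: "{p, m} \<subseteq> set (c i)"
      using wf_mixed_legs[OF wf] by blast
    have "p \<noteq> m" using wf_mixed_distinct[OF wf, of t p m] by simp
    obtain us vs where us: "c i = us @ p # vs" using i split_list[of p "c i"] by blast
    then consider "m \<in> set us" | "m \<in> set vs" using i \<open>p \<noteq> m\<close> by auto
    then show ?thesis
    proof cases
      case 1
      \<comment> \<open>Here the leg \<open>-\<close> comes first; exchanging the labels of the legs
        costs a sign and restores the form of \<open>slide_leg\<close>.\<close>
      then obtain xs ys where "us = xs @ m # ys" using split_list by metis
      then have c: "c = c(i := xs @ [m] @ ys @ [p] @ vs)" using us by (simp add: fun_upd_idem)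
      have "mixed_sum c C V (insert (t, m, p) W0) \<in> strutless_space"
        using slide_leg[of c i xs m ys p vs C V t W0, folded c] swapped(2,3) card less.prems(2) by blast
      then show ?thesis
        using neg_in_strutless_space unfolding W(1) swapped(1) by fastforce
    next
      case 2
      then obtain ys zs where "vs = ys @ m # zs" using split_list by metis
      then have c: "c = c(i := us @ [p] @ ys @ [m] @ zs)" using us by (simp add: fun_upd_idem)
      show ?thesis
        using slide_leg[of c i us p ys m zs C V t W0, folded c] wf W(2) card less.prems(2)
        unfolding W(1) by blast
    qed
  qed
qed

section \<open>Strutless diagrams lie in the image of \<open>\<iota>\<close>\<close>

definition iota_image :: "('l::finite) At set" where
  "iota_image = range (\<lambda>x :: 'l wedge_diagram free_space. At_of_Ac (iota x))"

interpretation iota: Vector_Spaces.linear free_scale scale_Ac iota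
  by (rule linear_iota)

interpretation At_of_Ac: Vector_Spaces.linear scale_Ac scale_At At_of_Ac
  by (rule linear_At_of_Ac)

lemma subspace_iota_image: "At.subspace iota_image"
proof -
  have "At.subspace (At_of_Ac ` range iota)"
    by (intro At_of_Ac.subspace_image iota.subspace_image free.subspace_UNIV)
  then show ?thesis
    by (simp add: iota_image_def image_image)
qed

section \<open>Wedge diagrams as mixed diagrams\<close>

lemma wf_mixed_of_wf_wedge:
  "wf_wedge W \<Longrightarrow> wf_mixed (wcircles W) {} {} (wedges W)"
  unfolding wf_wedge_def wf_mixed_def wedge_support_def
  by (auto simp: wf_graph_def partition_on_def)

lemma wf_wedge_of_wf_mixed:
  assumes "wf_mixed c {} {} W"
  shows "wf_wedge (Wedge_Pres c W)"
proof -
  have "points c = wedge_support W"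
    using wf_graph_Union[OF wf_mixed_graph[OF assms]] wf_mixed_support(1)[OF assms] by auto
  then show ?thesis
    using assms unfolding wf_wedge_def wf_mixed_def wedge_support_def by auto
qed

text \<open>One side keeps the ends of the chosen chords, the other drops the lost legs. Both leave
  the same points, since the chosen chords cover exactly the points that are not lost.\<close>

lemma chord_to_tri_keep_legs:
  assumes "wf_wedge W"
  shows "chord_to_tri (keep_legs W S) = mixed_resolution (wcircles W) {} {} (wedges W) S"
proof -
  let ?L = "lost_leg S ` wedges W"
  have leg: "leg_chord S = (\<lambda>(t, p, m). {t, if (t, p, m) \<in> S then m else p})"
    by (simp add: leg_chord_def)
  have "wf_graph (points (drop_points ?L (wcircles W))) (leg_chord S ` wedges W) {}"
    using wf_tri_mixed_resolution[OF wf_mixed_of_wf_wedge[OF assms], of S]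
    by (simp add: mixed_resolution_def wf_tri_iff)
  from wf_graph_Union[OF this] have "\<Union>(leg_chord S ` wedges W) = points (wcircles W) - ?L"
    by simp
  moreover have "set (wcircles W i) \<subseteq> points (wcircles W)" for i
    unfolding points_def by blast
  ultimately have "filter (\<lambda>x. x \<in> \<Union>(leg_chord S ` wedges W)) (wcircles W i) =
      drop_points ?L (wcircles W) i" for i
    unfolding drop_points_def by (intro filter_cong) auto
  then show ?thesis
    by (simp add: chord_to_tri_def keep_legs_def mixed_resolution_def Let_def leg[symmetric])
qed

lemma iota_gen_eq_mixed_sum:
  assumes "wf_wedge W"
  shows "At_of_Ac (iota (gen (abs_wedge_diagram W))) = mixed_sum (wcircles W) {} {} (wedges W)"
proof -
  have "At_of_Ac (abs_Ac (gen (abs_chord_diagram (keep_legs W S)))) =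
      diagram_class (mixed_resolution (wcircles W) {} {} (wedges W) S)" for S
    using wf_keep_legs[OF assms, of S]
    by (simp add: At_of_Ac.abs_eq trivalent_of_chord.abs_eq chord_iso_refl diagram_class_def
        chord_to_tri_keep_legs[OF assms])
  then show ?thesis
    by (simp add: iota_gen[OF assms] mixed_sum_def At_of_Ac.sum At_of_Ac.scale)
qed

section \<open>Finding an internal vertex next to a circle\<close>

lemma cyc3_rotate: "cyc3 x y z = cyc3 y z x"
  by (auto simp: cyc3_def)

lemma wf_graph_vertexE:
  assumes "wf_graph P C V" "v \<in> V"
  obtains x y z where "distinct [x, y, z]" "v = cyc3 x y z"
  using assms unfolding wf_graph_def by meson

lemma wf_graph_pathE:
  assumes "wf_graph P C V" "h \<in> P \<union> half_edges V"
  obtains e where "e \<in> P" "(h, e) \<in> (adj C V)\<^sup>*"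
  using assms unfolding wf_graph_def by meson

text \<open>Some path leads from an internal half-edge to an external vertex. It first leaves the
  internal half-edges along a chord with one end of each kind, and that chord is the one
  sought.\<close>

lemma ex_external_chord:
  assumes wf: "wf_graph P C V" and "V \<noteq> {}"
  obtains e h p q where "e \<in> P" "{e, h} \<in> C" "cyc3 h p q \<in> V" "distinct [h, p, q]"
proof -
  \<comment> \<open>The cyclic order may be rotated to start at the given half-edge.\<close>
  have vertex: "\<exists>p q. cyc3 x p q \<in> V \<and> distinct [x, p, q]" if "x \<in> half_edges V" for x
  proof -
    obtain v where v: "v \<in> V" "x \<in> Field v" using \<open>x \<in> half_edges V\<close> unfolding half_edges_def by blast
    obtain a b c where "distinct [a, b, c]" "v = cyc3 a b c"
      using wf v(1) by (rule wf_graph_vertexE)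
    then show ?thesis
      using v cyc3_rotate[of a b c] cyc3_rotate[of b c a] by auto metis+
  qed
  have disj: "P \<inter> half_edges V = {}" using wf by (simp add: wf_graph_def)
  have path: "\<exists>e h. e \<in> P \<and> {e, h} \<in> C \<and> h \<in> half_edges V"
    if "(x, y) \<in> (adj C V)\<^sup>*" "y \<in> P" "x \<in> half_edges V" for x y
    using that
  proof (induction rule: converse_rtrancl_induct)
    case base
    then show ?case using disj by blast
  next
    case (step x z)
    show ?case
    proof (cases "z \<in> half_edges V")
      case True
      then show ?thesis using step by blast
    next
      case False
      \<comment> \<open>A step inside a vertex would stay among the internal half-edges.\<close>
      from step(1) obtain A where A: "A \<in> C" "x \<in> A" "z \<in> A"
        by (rule adjE) (use False in \<open>auto simp: half_edges_def\<close>)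
      then have "z \<in> P" using wf_graph_Union[OF wf] False by blast
      moreover have "x \<noteq> z" using False step.prems by blast
      then have "A = {z, x}" using A wf_graph_chordE[OF wf A(1,2)] by (metis insert_commute insertE singletonD)
      ultimately show ?thesis using A(1) step.prems(2) by blast
    qed
  qed
  obtain v where "v \<in> V" using \<open>V \<noteq> {}\<close> by blast
  obtain a b c where "v = cyc3 a b c"
    using wf \<open>v \<in> V\<close> by (rule wf_graph_vertexE)
  with \<open>v \<in> V\<close> have a: "a \<in> half_edges V" unfolding half_edges_def by force
  then obtain y where "y \<in> P" "(a, y) \<in> (adj C V)\<^sup>*" using wf_graph_pathE[OF wf, of a] by blast
  then obtain e h where "e \<in> P" "{e, h} \<in> C" "h \<in> half_edges V" using path a by blast
  then show ?thesis using vertex that by blast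
qed

text \<open>
  Exchanging \<open>p\<close> and \<open>q\<close> where \<open>{t, p}\<close> is a strut amounts to replacing the strut by a wedge
  with tip \<open>t\<close> and legs on both sides of \<open>q\<close>.
\<close>
lemma strut_to_wedge:
  fixes c :: "('l::finite) circles"
  assumes wf: "wf_mixed (c(i := xs @ [p, q] @ zs)) (insert {t, p} C) V W" and "{t, p} \<notin> C"
    and t: "t \<in> points (c(i := xs @ [p, q] @ zs))" "t \<noteq> p"
    and m: "m \<notin> points (c(i := xs @ [p, q] @ zs)) \<union> half_edges V"
  shows "wf_mixed (c(i := xs @ [p, q, m] @ zs)) C V (insert (t, p, m) W)"
    and "(t, p, m) \<notin> W"
    and "mixed_sum (c(i := xs @ [p, q, m] @ zs)) C V (insert (t, p, m) W) =
      mixed_sum (c(i := xs @ [p, q] @ zs)) (insert {t, p} C) V W -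
      mixed_sum (c(i := xs @ [q, p] @ zs)) (insert {t, p} C) V W"
proof -
  let ?P = "points (c(i := xs @ zs))"
  let ?c = "c(i := xs @ [p, q] @ zs)" and ?c1 = "c(i := xs @ [p, q, m] @ zs)"
  have points: "points ?c = {p, q} \<union> ?P" "points ?c1 = {p, q, m} \<union> ?P"
    unfolding points_upd by simp_all
  have circ: "wf_circles (c(i := xs @ zs))" "p \<noteq> q" "{p, q} \<inter> ?P = {}"
    using wf_mixed_circles[OF wf] unfolding wf_circles_upd by auto
  have mP: "m \<noteq> p" "m \<noteq> q" "m \<notin> ?P" "m \<noteq> t" "m \<notin> half_edges V"
    using m t unfolding points by auto
  have mW: "m \<notin> wedge_support W"
    using wf_mixed_support(1)[OF wf] m by blast
  then show notin: "(t, p, m) \<notin> W"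
    unfolding wedge_support_def by fastforce
  have fresh: "{t, p} \<inter> \<Union>C = {}"
    using wf_graph_chord_eq[OF wf_mixed_graph[OF wf], of "{t, p}"] \<open>{t, p} \<notin> C\<close> by blast
  have "p \<in> \<Union>(insert {t, p} C)" "p \<in> points ?c" unfolding points by auto
  then have p: "p \<notin> half_edges V" "p \<notin> wedge_support W"
    using wf_mixed_points_half_edges[OF wf] unfolding wf_mixed_Union[OF wf] by blast+
  have filt: "filter (\<lambda>x. x \<notin> {a}) us = us" if "a \<in> {p, m}" "set us \<subseteq> ?P" for a us
    using that circ(3) mP(3) by (intro filter_True) auto
  have filts: "filter (\<lambda>x. x \<notin> {a}) xs = xs" "filter (\<lambda>x. x \<notin> {a}) zs = zs"
    "\<And>j. j \<noteq> i \<Longrightarrow> filter (\<lambda>x. x \<notin> {a}) (c j) = c j" if "a \<in> {p, m}" for a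
    using filt[OF that] set_subset_points_upd[of xs zs c i] points_subset_points_upd[of _ i c xs zs] by auto
  have drop: "drop_points {m} ?c1 = ?c" "drop_points {p} ?c1 = c(i := xs @ [q, m] @ zs)"
    using filts[of m] filts[of p] circ(2) mP by (auto simp: drop_points_def)
  have circ1: "wf_circles ?c1"
    unfolding wf_circles_upd using circ mP by auto
  have "{p, m} \<subseteq> set (?c1 i)" "t \<in> points ?c1" using t(1) unfolding points by auto
  then show wf1: "wf_mixed ?c1 C V (insert (t, p, m) W)"
    using fresh t(2) circ1 mP mW by (intro wf_mixed_insertI[where i = i]) (simp_all only: drop wf, auto)
  have chords: "(\<lambda>A. transpose p m ` A) ` insert {t, p} C = insert {t, m} C"
  proof -
    have "m \<notin> \<Union>C"
    proof
      assume "m \<in> \<Union>C"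
      then have "m \<in> \<Union>(insert {t, p} C)" by blast
      then show False using m unfolding wf_mixed_Union[OF wf] by blast
    qed
    then show ?thesis
      using fresh image_transpose_fresh[of p m C] t(2) mP(4) by simp
  qed
  have map: "map (transpose p m) [q, p] = [q, m]" using circ(2) mP by simp
  \<comment> \<open>The term keeping \<open>m\<close> has the strut end after \<open>q\<close>;
    renaming \<open>m\<close> to \<open>p\<close> makes it the diagram with \<open>p\<close> and
    \<open>q\<close> exchanged.\<close>
  have "mixed_sum (c(i := xs @ [q, m] @ zs)) (insert {t, m} C) V W =
      mixed_sum (c(i := xs @ [q, p] @ zs)) (insert {t, p} C) V W"
    using mixed_sum_transpose[of c i xs "[q, p]" zs "insert {t, p} C" V W p m]
      wf_mixed_swap[OF wf] wf_mixed_insertD'[OF wf1 notin] p circ(3) mP mW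
    unfolding drop chords map by blast
  then show "mixed_sum ?c1 C V (insert (t, p, m) W) =
      mixed_sum ?c (insert {t, p} C) V W - mixed_sum (c(i := xs @ [q, p] @ zs)) (insert {t, p} C) V W"
    using mixed_sum_insert[OF _ notin, of ?c1 C V] wf_mixed_finite[OF wf] unfolding drop by simp
qed

text \<open>The induction hypothesis on the number of internal vertices. The wedges are
  unrestricted, because opening struts adds new ones.\<close>

locale wedges_below =
  fixes n :: nat and l :: "('l::finite) itself"
  assumes mixed_sum_below:
    "\<And>(c :: 'l circles) C V W. wf_mixed c C V W \<Longrightarrow> card V < n \<Longrightarrow> \<forall>A\<in>C. \<not> A \<subseteq> points c \<Longrightarrow>
      mixed_sum c C V W \<in> iota_image"
begin

text \<open>
  If the chord at \<open>q\<close> is a strut as well, it is replaced by a wedge whose leg \<open>-\<close> comes after both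
  legs of the first wedge; the first wedge then contributes nothing to the term keeping that leg.
\<close>
lemma swap_strut:
  fixes c :: "'l circles"
  assumes wf: "wf_mixed (c(i := xs @ [p, q] @ zs)) C V W" and "card V < n"
    and P: "{t, p} \<in> C" "t \<in> points (c(i := xs @ [p, q] @ zs))" "t \<noteq> p" "t \<noteq> q"
    and strut: "\<And>A. A \<in> C \<Longrightarrow> A \<subseteq> points (c(i := xs @ [p, q] @ zs)) \<Longrightarrow> A \<inter> {p, q} \<noteq> {}"
  shows "mixed_sum (c(i := xs @ [p, q] @ zs)) C V W - mixed_sum (c(i := xs @ [q, p] @ zs)) C V W
    \<in> iota_image"
proof -
  let ?P = "points (c(i := xs @ [p, q] @ zs))"
  define C1 where "C1 = C - {{t, p}}"
  have C: "C = insert {t, p} C1" "{t, p} \<notin> C1" using P(1) by (auto simp: C1_def)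
  obtain m m' where m: "m \<noteq> m'"
      "{m, m'} \<inter> (?P \<union> half_edges V \<union> wedge_support W \<union> \<Union>C) = {}"
    by (rule ex_two_fresh[OF finite_labels[OF wf]])
  have mP: "m \<notin> ?P \<union> half_edges V" using m(2) by blast
  note wedge = strut_to_wedge[OF wf[unfolded C(1)] C(2) P(2,3) mP]
  let ?W = "insert (t, p, m) W" and ?c = "c(i := xs @ [p, q, m] @ zs)"
  have points: "points ?c = insert m ?P"
    unfolding points_upd[of c i xs "[p, q, m]"] points_upd[of c i xs "[p, q]"] by auto
  have unique: "A = B" if "A \<in> C" "B \<in> C" "x \<in> A" "x \<in> B" for A B x
    using wf_graph_chord_eq[OF wf_mixed_graph[OF wf]] that by blast
  have m_notin: "m \<notin> \<Union>C" "m' \<notin> \<Union>C" using m(2) by blast+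
  \<comment> \<open>Once \<open>{t, p}\<close> has been opened, no chord ends at \<open>p\<close>,
    so a remaining strut can only end at \<open>q\<close>.\<close>
  have struts: "q \<in> A" if "A \<in> C1" "A \<subseteq> points ?c" for A
  proof -
    have "A \<subseteq> ?P" using that m_notin(1) unfolding points C(1) by blast
    moreover have "A \<in> C" "p \<notin> A" using that(1) C unique[of A "{t, p}" p] by auto
    ultimately show ?thesis using strut[of A] by blast
  qed
  have "mixed_sum ?c C1 V ?W \<in> iota_image"
  proof (cases "\<exists>A\<in>C1. A \<subseteq> points ?c")
    case False
    then show ?thesis
      using wedge(1) \<open>card V < n\<close> by (intro mixed_sum_below) blast+
  next
    case True
    then obtain Q where Q: "Q \<in> C1" "Q \<subseteq> points ?c" by blast
    then have "q \<in> Q" by (rule struts)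
    have "Q \<in> C" using Q(1) C(1) by blast
    then obtain s where s: "Q = {q, s}" "q \<noteq> s"
      using wf_graph_chordE[OF wf_mixed_graph[OF wf] _ \<open>q \<in> Q\<close>] by blast
    define C2 where "C2 = C1 - {{s, q}}"
    have C1: "C1 = insert {s, q} C2" "{s, q} \<notin> C2"
      using Q(1) s(1) by (auto simp: C2_def insert_commute)
    have lists: "(xs @ [p]) @ [q, m] @ zs = xs @ [p, q, m] @ zs"
      "(xs @ [p]) @ [m, q] @ zs = xs @ [p, m] @ q # zs"
      "(xs @ [p]) @ [q, m, m'] @ zs = xs @ [p, q, m, m'] @ zs" by simp_all
    have wf': "wf_mixed (c(i := (xs @ [p]) @ [q, m] @ zs)) (insert {s, q} C2) V ?W"
      using wedge(1) C1(1) by (simp only: lists)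
    have "s \<in> points ?c" using Q(2) s(1) by blast
    moreover have "m' \<notin> points ?c \<union> half_edges V" using m unfolding points by blast
    ultimately have side: "s \<in> points (c(i := (xs @ [p]) @ [q, m] @ zs))"
      "m' \<notin> points (c(i := (xs @ [p]) @ [q, m] @ zs)) \<union> half_edges V"
      unfolding lists by blast+
    note wedge' = strut_to_wedge[OF wf' C1(2) side(1) s(2)[symmetric] side(2), unfolded lists]
    \<comment> \<open>In the subtracted term \<open>q\<close> has moved past \<open>m\<close>, which
      makes the legs \<open>p\<close> and \<open>m\<close> of the first wedge adjacent.\<close>
    have "wf_mixed (c(i := xs @ [p, m] @ q # zs)) (insert {s, q} C2) V ?W"
      using wf_mixed_swap[OF wf'] by (simp only: lists)
    then have "mixed_sum (c(i := xs @ [p, m] @ q # zs)) (insert {s, q} C2) V ?W = 0"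
      using wedge(2) by (rule mixed_sum_adjacent_legs)
    then have "mixed_sum ?c C1 V ?W =
        mixed_sum (c(i := xs @ [p, q, m, m'] @ zs)) C2 V (insert (s, q, m') ?W)"
      using wedge'(3) C1(1) by simp
    \<comment> \<open>A strut left over would end at \<open>q\<close> and hence be
      \<open>{s, q}\<close>, which is no longer in \<open>C2\<close>.\<close>
    moreover have "\<not> A \<subseteq> points (c(i := xs @ [p, q, m, m'] @ zs))" if "A \<in> C2" for A
    proof
      assume A: "A \<subseteq> points (c(i := xs @ [p, q, m, m'] @ zs))"
      have pts: "points (c(i := xs @ [p, q, m, m'] @ zs)) = insert m' (points ?c)"
        unfolding points_upd[of c i xs "[p, q, m, m']"] points_upd[of c i xs "[p, q, m]"] by auto
      have "A \<in> C1" "A \<in> C" using that C(1) C1(1) by blast+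
      then have "A \<subseteq> points ?c" using A m_notin(2) unfolding pts by blast
      with \<open>A \<in> C1\<close> have "q \<in> A" by (rule struts)
      then have "A = {s, q}" using unique[of A Q q] \<open>A \<in> C\<close> \<open>Q \<in> C\<close> s(1) by auto
      then show False using that C1(2) by blast
    qed
    ultimately show ?thesis
      using wedge'(1) \<open>card V < n\<close> mixed_sum_below by metis
  qed
  then show ?thesis
    unfolding wedge(3) C(1) .
qed

text \<open>Handles the difference produced by resolving a vertex with STU, where struts can arise
  only at the new external vertices. The cases are given by the chords \<open>P\<close> and
  \<open>Q\<close> ending there.\<close>

lemma swap_vertex:
  fixes c :: "'l circles"
  assumes wf: "wf_mixed (c(i := xs @ [p, q] @ zs)) C V W" and "card V < n"
    and pq: "p \<in> \<Union>C" "q \<in> \<Union>C"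
    and strut: "\<And>A. A \<in> C \<Longrightarrow> A \<subseteq> points (c(i := xs @ [p, q] @ zs)) \<Longrightarrow> A \<inter> {p, q} \<noteq> {}"
  shows "mixed_sum (c(i := xs @ [p, q] @ zs)) C V W - mixed_sum (c(i := xs @ [q, p] @ zs)) C V W
    \<in> iota_image"
proof -
  let ?c = "c(i := xs @ [p, q] @ zs)" and ?c' = "c(i := xs @ [q, p] @ zs)"
  have points: "points ?c' = points ?c"
    unfolding points_upd[of c i xs "[p, q]"] points_upd[of c i xs "[q, p]"] by auto
  have circ: "p \<noteq> q" "{p, q} \<inter> points (c(i := xs @ zs)) = {}"
    using wf_mixed_circles[OF wf] unfolding wf_circles_upd by auto
  have graph: "wf_graph (points ?c - wedge_support W) C V" using wf by (rule wf_mixed_graph)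
  have unique: "A = B" if "A \<in> C" "B \<in> C" "x \<in> A" "x \<in> B" for A B x
    using wf_graph_chord_eq[OF graph] that by blast
  obtain P Q where PQ: "P \<in> C" "p \<in> P" "Q \<in> C" "q \<in> Q" using pq by blast
  obtain t where t: "P = {p, t}" "p \<noteq> t" using graph PQ(1,2) by (rule wf_graph_chordE)
  obtain s where s: "Q = {q, s}" "q \<noteq> s" using graph PQ(3,4) by (rule wf_graph_chordE)
  note wf' = wf_mixed_swap[OF wf]
  have "{p, q} \<subseteq> points ?c" unfolding points_upd by simp
  consider "P = Q" | "P \<noteq> Q" "P \<subseteq> points ?c" | "P \<noteq> Q" "Q \<subseteq> points ?c"
    | "\<not> P \<subseteq> points ?c" "\<not> Q \<subseteq> points ?c" by blast
  then show ?thesis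
  proof cases
    case 1
    then have t: "P = {p, q}" using t s circ(1) by auto
    \<comment> \<open>A single chord joins \<open>p\<close> and \<open>q\<close>, so exchanging
      their order is a mere renaming and the difference is zero.\<close>
    have "transpose p q ` A = A" if "A \<in> C" for A
    proof (cases "A = {p, q}")
      case False
      then have "z \<in> A \<Longrightarrow> transpose p q z = z" for z
        using unique[of A P] PQ(1) that t by (intro transpose_apply_other) auto
      then show ?thesis by simp
    qed auto
    then have chords: "(\<lambda>A. transpose p q ` A) ` C = C" by simp
    have map: "map (transpose p q) [p, q] = [q, p]" by simp
    have "{p, q} \<inter> half_edges V = {}" "{p, q} \<inter> wedge_support W = {}"
      using wf_mixed_points_half_edges[OF wf] \<open>{p, q} \<subseteq> points ?c\<close> pq
      unfolding wf_mixed_Union[OF wf] by blast+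
    then have "mixed_sum ?c' C V W = mixed_sum ?c C V W"
      using mixed_sum_transpose[of c i xs "[p, q]" zs C V W p q] wf wf' circ(2)
      unfolding map chords by blast
    then show ?thesis
      using At.subspace_0[OF subspace_iota_image] by simp
  next
    case 2
    have "t \<noteq> q" using 2(1) unique[of P Q q] PQ t by blast
    then show ?thesis
      using swap_strut[OF wf \<open>card V < n\<close> _ _ _ _ strut, of t] 2(2) PQ(1) t
      by (auto simp: insert_commute)
  next
    \<comment> \<open>The strut ends at \<open>q\<close>: \<open>swap_strut\<close> is used with the
      roles of \<open>p\<close> and \<open>q\<close> exchanged, which changes the sign.\<close>
    case 3
    have "s \<noteq> p" using 3(1) unique[of P Q p] PQ s by blast
    then have "mixed_sum ?c' C V W - mixed_sum ?c C V W \<in> iota_image"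
      using swap_strut[OF wf' \<open>card V < n\<close>, of s] 3(2) PQ(3) s strut
      unfolding points by (auto simp: insert_commute)
    then show ?thesis
      using At.subspace_neg[OF subspace_iota_image] by fastforce
  next
    \<comment> \<open>Without struts at either end there are none at all, and the hypothesis covers
      both diagrams.\<close>
    case 4
    have "\<not> A \<subseteq> points ?c" if "A \<in> C" for A
      using strut[of A] unique[of A P p] unique[of A Q q] PQ 4 that by blast
    then have "mixed_sum ?c C V W \<in> iota_image" "mixed_sum ?c' C V W \<in> iota_image"
      using wf wf' \<open>card V < n\<close> points by (simp_all add: mixed_sum_below)
    then show ?thesis
      using At.subspace_diff[OF subspace_iota_image] by blast
  qed
qed

end

lemma mixed_sum_in_iota_image:
  fixes c :: "('l::finite) circles"
  assumes "wf_mixed c C V W" "\<forall>A\<in>C. \<not> A \<subseteq> points c"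
  shows "mixed_sum c C V W \<in> iota_image"
  using assms
proof (induction "card V" arbitrary: c C V W rule: less_induct)
  case less
  interpret wedges_below "card V" "TYPE('l)"
    by unfold_locales (use less.hyps in blast)
  note wf = less.prems(1)
  note graph = wf_mixed_graph[OF wf]
  show ?case
  proof (cases "V = {}")
    case True
    \<comment> \<open>Without internal vertices every chord is a strut, so none exist and only
      wedges are left.\<close>
    have "A \<subseteq> points c" if "A \<in> C" for A
      using that wf_mixed_Union[OF wf] True by auto
    then have "C = {}" using less.prems(2) by blast
    then have "mixed_sum c C V W = At_of_Ac (iota (gen (abs_wedge_diagram (Wedge_Pres c W))))"
      using wf True by (simp add: iota_gen_eq_mixed_sum wf_wedge_of_wf_mixed)
    then show ?thesis
      unfolding iota_image_def by blast
  next
    case False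
    obtain e h p q where e: "e \<in> points c - wedge_support W" "{e, h} \<in> C"
      and v: "cyc3 h p q \<in> V" "distinct [h, p, q]"
      by (rule ex_external_chord[OF graph False])
    define C' V' where "C' = C - {{e, h}}" and "V' = V - {cyc3 h p q}"
    have C: "C = insert {e, h} C'" "{e, h} \<notin> C'" and V: "V = insert (cyc3 h p q) V'" "cyc3 h p q \<notin> V'"
      using e(2) v(1) by (auto simp: C'_def V'_def)
    have "finite V" using graph by (simp add: wf_graph_def)
    then have card: "card V' < card V" using V by simp
    obtain i where "e \<in> set (c i)" using e(1) unfolding points_def by blast
    then obtain xs zs where "c i = xs @ [e] @ zs" using split_list by force
    then have c: "c = c(i := xs @ [e] @ zs)" by (simp add: fun_upd_idem)
    let ?P = "points (c(i := xs @ zs))"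
    have points: "points c = insert e ?P" "e \<notin> ?P"
      using wf_mixed_circles[OF wf] points_upd[of c i xs "[e]" zs] wf_circles_upd[of c i xs "[e]" zs]
      unfolding c[symmetric] by auto
    have half: "{h, p, q} \<inter> points c = {}" "e \<notin> half_edges V" "{h, p, q} \<inter> wedge_support W = {}"
      using wf_mixed_points_half_edges[OF wf] wf_mixed_support(2)[OF wf] e(1) V(1) by auto
    have "Field (cyc3 h p q) \<inter> Field v = {}" if "v \<in> V'" for v
      using graph that V unfolding wf_graph_def by (metis insert_iff)
    then have half': "{h, p, q} \<inter> half_edges V' = {}"
      unfolding half_edges_def Field_cyc3 by blast
    have C': "{e, h} \<inter> \<Union>C' = {}"
      using wf_graph_chord_eq[OF graph, of "{e, h}"] C by blast
    have fresh: "distinct [e, h, p, q]"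
      "{e, h, p, q} \<inter> (?P \<union> half_edges V' \<union> wedge_support W) = {}"
      using v(2) half half' e(1) points V(1) by auto
    have wf': "wf_mixed (c(i := xs @ [p, q] @ zs)) C' V' W"
      using wf_mixed_STU[OF fresh C'] wf unfolding c[symmetric] C(1)[symmetric] V(1)[symmetric] by blast
    have sum: "mixed_sum c C V W =
        mixed_sum (c(i := xs @ [q, p] @ zs)) C' V' W - mixed_sum (c(i := xs @ [p, q] @ zs)) C' V' W"
      using mixed_sum_STU[OF fresh C' wf'] unfolding c[symmetric] C(1)[symmetric] V(1)[symmetric] .
    have "\<Union>C = points c - wedge_support W \<union> half_edges V" using wf by (rule wf_mixed_Union)
    then have "{p, q} \<subseteq> \<Union>C" unfolding V(1) by auto
    moreover have "p \<noteq> e" "p \<noteq> h" "q \<noteq> e" "q \<noteq> h" using fresh(1) by auto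
    ultimately have pq: "p \<in> \<Union>C'" "q \<in> \<Union>C'" unfolding C(1) by auto
    \<comment> \<open>A strut missing both new external vertices would already be a strut of the
      original diagram.\<close>
    have strut: "A \<inter> {q, p} \<noteq> {}" if "A \<in> C'" "A \<subseteq> points (c(i := xs @ [q, p] @ zs))" for A
    proof
      assume "A \<inter> {q, p} = {}"
      then have "A \<subseteq> points c" using that(2) unfolding points points_upd[of c i xs "[q, p]"] by auto
      then show False using less.prems(2) that(1) C(1) by blast
    qed
    show ?thesis
      unfolding sum by (rule swap_vertex[OF wf_mixed_swap[OF wf'] card pq(2,1) strut])
  qed
qed

text \<open>Writes \<open>x\<close> as a combination of generators, which reduces the inclusion into
  the strutless space to single wedge diagrams.\<close>

lemma free_extend_gen_eq: "free_extend gen x = x"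
proof (rule poly_mapping_eqI)
  fix d
  have "Poly_Mapping.lookup (free_extend gen x) d =
      (\<Sum>d'\<in>Poly_Mapping.keys x. Poly_Mapping.lookup x d' * Poly_Mapping.lookup (gen d') d)"
    by (simp add: free_extend_def lookup_sum)
  also have "\<dots> = (\<Sum>d'\<in>Poly_Mapping.keys x. if d' = d then Poly_Mapping.lookup x d' else 0)"
    by (intro sum.cong) (auto simp: gen_def lookup_single)
  also have "\<dots> = Poly_Mapping.lookup x d"
    by (simp add: in_keys_iff)
  finally show "Poly_Mapping.lookup (free_extend gen x) d = Poly_Mapping.lookup x d" .
qed

lemma wedge_diagram_cases:
  obtains W where "wf_wedge W" "d = abs_wedge_diagram W"
proof
  show "d = abs_wedge_diagram (rep_wedge_diagram d)"
    using Quotient3_abs_rep[OF Quotient3_wedge_diagram] by metis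
  show "wf_wedge (rep_wedge_diagram d)"
    using Quotient3_rep_reflp[OF Quotient3_wedge_diagram] unfolding wedge_iso_def by blast
qed

theorem theorem5p2:
  shows "range (\<lambda>x :: ('l::finite) wedge_diagram free_space. At_of_Ac (iota x)) = strutless_space"
proof
  show "range (\<lambda>x :: 'l wedge_diagram free_space. At_of_Ac (iota x)) \<subseteq> strutless_space"
  proof (rule image_subsetI)
    fix x :: "'l wedge_diagram free_space"
    have "At_of_Ac (iota x) = At_of_Ac (iota (free_extend gen x))"
      by (simp only: free_extend_gen_eq)
    also have "\<dots> = (\<Sum>d\<in>Poly_Mapping.keys x. scale_At (Poly_Mapping.lookup x d) (At_of_Ac (iota (gen d))))"
      by (simp add: free_extend_def iota.sum iota.scale At_of_Ac.sum At_of_Ac.scale)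
    also have "\<dots> \<in> strutless_space"
      unfolding strutless_space_def
    proof (intro At.span_sum At.span_scale)
      fix d :: "'l wedge_diagram"
      obtain W where "wf_wedge W" "d = abs_wedge_diagram W" by (rule wedge_diagram_cases)
      then have "At_of_Ac (iota (gen d)) \<in> strutless_space"
        by (simp add: iota_gen_eq_mixed_sum mixed_sum_in_strutless_space wf_mixed_of_wf_wedge)
      then show "At_of_Ac (iota (gen d)) \<in>
          At.span {abs_At (gen (abs_trivalent_diagram D)) | D. wf_tri D \<and> strutless D}"
        unfolding strutless_space_def .
    qed
    finally show "At_of_Ac (iota x) \<in> strutless_space" .
  qed
next
  have "strutless_space \<subseteq> (iota_image :: 'l At set)"
    unfolding strutless_space_def
  proof (rule At.span_minimal[OF _ subspace_iota_image], clarify)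
    fix D :: "'l tri_pres"
    assume D: "wf_tri D" "strutless D"
    obtain c C V where D_eq: "D = Tri_Pres c C V" by (rule tri_pres.exhaust)
    \<comment> \<open>A trivalent diagram is a mixed diagram without wedges.\<close>
    have "wf_mixed c C V {}"
      using D(1) by (simp add: D_eq wf_mixed_def wf_tri_iff)
    then have "mixed_sum c C V {} \<in> iota_image"
      using D(2) by (intro mixed_sum_in_iota_image) (simp_all add: D_eq strutless_def external_def)
    then show "abs_At (gen (abs_trivalent_diagram D)) \<in> iota_image"
      by (simp add: D_eq diagram_class_def)
  qed
  then show "strutless_space \<subseteq> range (\<lambda>x :: 'l wedge_diagram free_space. At_of_Ac (iota x))"
    unfolding iota_image_def .
qed

end
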